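(* Consider the quantities computed by the $k$-step joint bidiagonalization (JBD) process in finite precision, with inner least squares problems solved accurately. Let $U_{k+1}=M_{k+1}R_{k+1}$ and $V_k=N_kS_k$ be the compact QR factorizations of $U_{k+1}$ and $V_k$, where the diagonals of $R_{k+1}$ and $S_k$ are positive, and let $\delta=O(\|\underline B_k^{-1}\|\epsilon)$. If $U_{k+1}$ and $V_k$ satisfy the semiorthogonality $$\xi(U_{k+1}),\ \xi(V_k)\le\sqrt{\delta/(2k+1)},$$ then $$M_{k+1}^TQ_AN_k=B_k+\widetilde E_k,$$ where the elements of $\widetilde E_k$ are $O(\delta)=O(\|\underline B_k^{-1}\|\epsilon)$ in size.
   Context: Setting. $A\in\mathbb{R}^{m\times n}$, $L\in\mathbb{R}^{p\times n}$ with $\mathrm{rank}\begin{pmatrix}A\\L\end{pmatrix}=n$. The compact QR factorization is $\begin{pmatrix}A\\L\end{pmatrix}=QR$ with $Q=\begin{pmatrix}Q_A\\Q_L\end{pmatrix}$, $Q^TQ=I_n$, $Q_A\in\mathbb{R}^{m\times n}$, $Q_L\in\mathbb{R}^{p\times n}$, $R$ nonsingular. $\|\cdot\|$ is the 2-norm, $\epsilon$ is the unit roundoff, and $e_j$ with $j=k$ or $k+1$ is the last column of $I_j$. For a matrix $W=(w_1,\dots,w_j)$, $\xi(W)=\max_{1\le i\ne l\le j}|w_i^Tw_l|$. JBD process (exact form). $\beta_1u_1=b$; $\alpha_1\tilde v_1=QQ^T(u_1^T,0_p^T)^T$; and for $i\ge 1$: $\beta_{i+1}u_{i+1}=\tilde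 v_i(1{:}m)-\alpha_iu_i$; $\alpha_{i+1}\tilde v_{i+1}=QQ^T(u_{i+1}^T,0_p^T)^T-\beta_{i+1}\tilde v_i$. The vector $QQ^T(u_i^T,0_p^T)^T$ is obtained by solving the inner least squares problem $\min_x\|\begin{pmatrix}A\\L\end{pmatrix}x-\begin{pmatrix}u_i\\0_p\end{pmatrix}\|$. Notation (computed quantities). $U_{k+1}=(u_1,\dots,u_{k+1})\in\mathbb{R}^{m\times(k+1)}$, $\widetilde V_k=(\tilde v_1,\dots,\tilde v_k)\in\mathbb{R}^{(m+p)\times k}$; all $u_i,\tilde v_i$ have unit length. $B_k\in\mathbb{R}^{(k+1)\times k}$ is lower bidiagonal with diagonal $\alpha_1,\dots,\alpha_k$ and subdiagonal $\beta_2,\dots,\beta_{k+1}$. $\underline{B}_k=\begin{pmatrix}B_{k-1}^T\\ \alpha_ke_k^T\end{pmatrix}\in\mathbb{R}^{k\times k}$ is upper bidiagonal with diagonal $\alpha_1,\dots,\alpha_k$ and superdiagonal $\beta_2,\dots,\beta_k$, assumed invertible. $v_i=Q^T\tilde v_i$ and $V_k=(v_1,\dots,v_k)$. Finite precision model (with accurate inner solves). The computed quantities satisfy $(I_m,0_{m\times p})\widetilde V_k=U_{k+1}B_k+\widetilde F_k$ and $QQ^T\begin{pmatrix}U_{k+1}\\0_{p\times(k+1)}\end{pmatrix}=\widetilde V_kB_k^T+\alpha_{k+1}\tilde v_{k+1}e_{k+1}^T+\widetilde G_{k+1}$, with $\|\widetilde F_k\|,\|\widetilde G_{k+1}\|=O(\epsilon)$.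 Local orthogonality: $\beta_{i+1}|u_{i+1}^Tu_i|=O(c_1\epsilon)$, with $c_1=c_1(m,n)$ a modest constant; no $\beta_{i+1}$ is negligible. Convention. $X=O(Y)$ means $|X|\le KY$ for a modest constant $K$ that does not depend on $\epsilon$ or on $\|\underline B_k^{-1}\|$ (it may depend on $k$ and $c_1$), with $\epsilon$ (and $\|\underline B_k^{-1}\|\epsilon$) sufficiently small. "$\delta=O(\|\underline B_k^{-1}\|\epsilon)$" means that $\delta=\kappa\|\underline B_k^{-1}\|\epsilon$ for a fixed modest constant $\kappa>0$, on which the constants in the conclusion may depend. *)

theory Defs
  imports Complex_Main "Jordan_Normal_Form.DL_Rank"
begin

definition norm2_vec :: "real vec \<Rightarrow> real" where
  "norm2_vec x = sqrt (x \<bullet> x)"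

definition norm2_mat :: "real mat \<Rightarrow> real" where
  "norm2_mat A = Sup {norm2_vec (A *\<^sub>v x) | x. x \<in> carrier_vec (dim_col A) \<and> norm2_vec x \<le> 1}"

text \<open>The element 0 is inserted only to fix the value 0 for a matrix with a single column;
  it has no effect otherwise, because the other elements are nonnegative.\<close>

definition xi :: "real mat \<Rightarrow> real" where
  "xi W = Max (insert 0 {\<bar>col W i \<bullet> col W l\<bar> | i l. i < dim_col W \<and> l < dim_col W \<and> i \<noteq> l})"

definition compact_qr :: "real mat \<Rightarrow> real mat \<Rightarrow> real mat \<Rightarrow> bool" where
  "compact_qr W Q R \<longleftrightarrow>
     Q \<in> carrier_mat (dim_row W) (dim_col W) \<and>
     R \<in> carrier_mat (dim_col W) (dim_col W) \<and>
     transpose_mat Q * Q = 1\<^sub>m (dim_col W) \<and>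
     upper_triangular R \<and>
     W = Q * R"

definition pos_diag :: "real mat \<Rightarrow> bool" where
  "pos_diag R \<longleftrightarrow> (\<forall>i < dim_row R. 0 < R $$ (i, i))"

text \<open>Sequences of scalars and vectors are indexed from 1 as in the mathematical notation, whereas
  matrix entries are indexed from 0. So \<open>cols_upto d w j\<close> is the matrix
  \<open>(w 1, ..., w j)\<close> with \<open>d\<close> rows.\<close>

definition cols_upto :: "nat \<Rightarrow> (nat \<Rightarrow> real vec) \<Rightarrow> nat \<Rightarrow> real mat" where
  "cols_upto d w j = mat_of_cols d (map w [1..<j + 1])"

text \<open>The \<open>(k + 1) \<times> k\<close> lower bidiagonal matrix with diagonal
  \<open>\<alpha> 1, ..., \<alpha> k\<close> and subdiagonal \<open>\<beta> 2, ..., \<beta> (k + 1)\<close>.\<close>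

definition bidiag :: "(nat \<Rightarrow> real) \<Rightarrow> (nat \<Rightarrow> real) \<Rightarrow> nat \<Rightarrow> real mat" where
  "bidiag \<alpha> \<beta> k = mat (k + 1) k (\<lambda>(i, j).
     if i = j then \<alpha> (j + 1) else if i = j + 1 then \<beta> (j + 2) else 0)"

text \<open>The \<open>k \<times> k\<close> upper bidiagonal matrix with diagonal
  \<open>\<alpha> 1, ..., \<alpha> k\<close> and superdiagonal \<open>\<beta> 2, ..., \<beta> k\<close>.\<close>

definition bidiag_upper :: "(nat \<Rightarrow> real) \<Rightarrow> (nat \<Rightarrow> real) \<Rightarrow> nat \<Rightarrow> real mat" where
  "bidiag_upper \<alpha> \<beta> k = mat k k (\<lambda>(i, j).
     if i = j then \<alpha> (j + 1) else if j = i + 1 then \<beta> (j + 1) else 0)"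

lemma bidiag_upper_block:
  assumes "1 \<le> k"
  shows "bidiag_upper \<alpha> \<beta> k =
    transpose_mat (bidiag \<alpha> \<beta> (k - 1)) @\<^sub>r mat_of_rows k [\<alpha> k \<cdot>\<^sub>v unit_vec k (k - 1)]"
  using assms
  by (intro eq_matI)
    (auto simp: bidiag_upper_def bidiag_def append_rows_def mat_of_rows_def unit_vec_def
      le_Suc_eq not_less less_Suc_eq)

text \<open>The finite precision model of the \<open>k\<close>-step process with accurate inner solves.
  \<open>F\<close> and \<open>G\<close> are the rounding error matrices of the two
  recurrences. \<open>c\<^sub>F\<close>, \<open>c\<^sub>G\<close>, \<open>c\<^sub>U\<close> are the constants hidden in the
  three O-terms, for \<open>F\<close>, \<open>G\<close> and the local orthogonality.
  \<open>c\<^sub>\<beta>\<close> is the multiple of the unit roundoff \<open>\<epsilon>\<close> up to which a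
  \<open>\<beta> i\<close> would count as negligible. No signs are imposed on the normalization factors.\<close>

definition jbd_finite_precision ::
  "nat \<Rightarrow> nat \<Rightarrow> nat \<Rightarrow> real mat \<Rightarrow> real \<Rightarrow> real \<Rightarrow> real \<Rightarrow> real \<Rightarrow> real \<Rightarrow> real \<Rightarrow>
   (nat \<Rightarrow> real) \<Rightarrow> (nat \<Rightarrow> real) \<Rightarrow> (nat \<Rightarrow> real vec) \<Rightarrow> (nat \<Rightarrow> real vec) \<Rightarrow> bool" where
  "jbd_finite_precision m p k Q \<epsilon> c\<^sub>1 c\<^sub>F c\<^sub>G c\<^sub>U c\<^sub>\<beta> \<alpha> \<beta> u vt \<longleftrightarrow>
     (\<forall>i \<in> {1..k + 1}. u i \<in> carrier_vec m \<and> norm2_vec (u i) = 1) \<and>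
     (\<forall>i \<in> {1..k + 1}. vt i \<in> carrier_vec (m + p) \<and> norm2_vec (vt i) = 1) \<and>
     (\<exists>F \<in> carrier_mat m k.
        four_block_mat (1\<^sub>m m) (0\<^sub>m m p) (0\<^sub>m 0 m) (0\<^sub>m 0 p) * cols_upto (m + p) vt k =
          cols_upto m u (k + 1) * bidiag \<alpha> \<beta> k + F \<and>
        norm2_mat F \<le> c\<^sub>F * \<epsilon>) \<and>
     (\<exists>G \<in> carrier_mat (m + p) (k + 1).
        Q * transpose_mat Q * (cols_upto m u (k + 1) @\<^sub>r 0\<^sub>m p (k + 1)) =
          cols_upto (m + p) vt k * transpose_mat (bidiag \<alpha> \<beta> k)
          + \<alpha> (k + 1) \<cdot>\<^sub>m
              (mat_of_cols (m + p) [vt (k + 1)] * mat_of_rows (k + 1) [unit_vec (k + 1) k])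
          + G \<and>
        norm2_mat G \<le> c\<^sub>G * \<epsilon>) \<and>
     (\<forall>i \<in> {1..k}. \<bar>\<beta> (i + 1)\<bar> * \<bar>u (i + 1) \<bullet> u i\<bar> \<le> c\<^sub>U * (c\<^sub>1 * \<epsilon>)) \<and>
     (\<forall>i \<in> {1..k}. c\<^sub>\<beta> * \<epsilon> < \<bar>\<beta> (i + 1)\<bar>)"

end

theory Submission
  imports Defs "HOL-Analysis.L2_Norm"
begin

text \<open>
  Write \<open>B\<close> for the lower bidiagonal matrix, \<open>T\<close> for the square upper bidiagonal one,
  \<open>\<eta>\<close> for the norm of the inverse of \<open>T\<close> times \<open>\<epsilon>\<close>, and \<open>X\<close> for \<open>M\<^sup>T Q\<^sub>A N\<close>. The second
  recurrence, restricted to its first \<open>k\<close> columns and multiplied by the inverse of \<open>T\<close>, shows that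
  the vectors \<open>vt i\<close> lie in the range of \<open>Q\<close> up to an error of order \<open>\<eta>\<close>
  (\<open>near_range_of_perturbed_projection\<close>). Hence \<open>Q\<^sub>A V = U B + F'\<close> with \<open>F'\<close> of order \<open>\<eta>\<close>, and
  the vectors \<open>v i\<close> have unit length up to order \<open>\<eta>\<^sup>2\<close>.

  Inserting the QR factorizations into this relation and into the second recurrence gives
  \<open>X S \<approx> R\<^sub>U B\<close> and, for the first \<open>k\<close> columns, \<open>X\<^sup>T R\<^sub>U \<approx> S T\<close>, both with errors of order
  \<open>\<eta>\<close>. The factors \<open>R\<^sub>U\<close> and \<open>S\<close> are close to the identity only up to order \<open>sqrt \<delta>\<close>, which
  alone would be too weak. But since all matrices involved are triangular or bidiagonal, the first
  relation determines the entries of \<open>X\<close> below the diagonal and the second one the other entries, and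
  in both cases \<open>R\<^sub>U\<close> and \<open>S\<close> contribute only quotients of diagonal entries
  (\<open>bidiagonal_from_triangular_relations\<close>, by \<open>forward_substitution\<close>). The diagonal entries
  differ from 1 only through the squares of the off-diagonal ones and through the lengths of the
  vectors \<open>v i\<close>, hence by order \<open>\<delta>\<close> (\<open>gram_factor_near_identity\<close>).

  The coefficients of \<open>B\<close> are bounded (\<open>bidiag_coefficients_le\<close>). This keeps the perturbed
  quotients harmless and also gives \<open>\<epsilon> \<le> 4 * \<eta>\<close>, so that every error is a multiple of \<open>\<eta>\<close>, with a
  factor that depends on \<open>k\<close> and the given constants only.
\<close>

section \<open>Euclidean vector norm and operator norm\<close>

lemma norm2_vec_L2_set: "norm2_vec x = L2_set (\<lambda>i. x $ i) {..<dim_vec x}"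
  by (simp add: norm2_vec_def L2_set_def scalar_prod_def power2_eq_square lessThan_atLeast0)

lemma norm2_vec_nonneg: "0 \<le> norm2_vec x"
  by (simp add: norm2_vec_L2_set)

lemma norm2_vec_sq: "(norm2_vec x)\<^sup>2 = x \<bullet> x"
  by (simp add: norm2_vec_def scalar_prod_def sum_nonneg)

lemma norm2_vec_smult: "norm2_vec (c \<cdot>\<^sub>v x) = \<bar>c\<bar> * norm2_vec x"
  by (simp add: norm2_vec_def real_sqrt_mult flip: mult.assoc power2_eq_square)

lemma norm2_vec_unit: "i < n \<Longrightarrow> norm2_vec (unit_vec n i) = 1"
  by (simp add: norm2_vec_def)

lemma norm2_vec_Cauchy_Schwarz:
  assumes "x \<in> carrier_vec n" "y \<in> carrier_vec n"
  shows "\<bar>x \<bullet> y\<bar> \<le> norm2_vec x * norm2_vec y"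
proof -
  have "\<bar>x \<bullet> y\<bar> \<le> (\<Sum>i<n. \<bar>x $ i\<bar> * \<bar>y $ i\<bar>)"
    using assms unfolding scalar_prod_def lessThan_atLeast0
    by (auto simp flip: abs_mult)
  also have "\<dots> \<le> norm2_vec x * norm2_vec y"
    using assms L2_set_mult_ineq[of "\<lambda>i. x $ i" "\<lambda>i. y $ i" "{..<n}"]
    by (simp add: norm2_vec_L2_set)
  finally show ?thesis .
qed

lemma norm2_vec_triangle:
  assumes "x \<in> carrier_vec n" "y \<in> carrier_vec n"
  shows "norm2_vec (x + y) \<le> norm2_vec x + norm2_vec y"
proof -
  have "norm2_vec (x + y) = L2_set (\<lambda>i. x $ i + y $ i) {..<n}"
    using assms by (auto simp: norm2_vec_L2_set intro!: L2_set_cong)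
  then show ?thesis
    using assms L2_set_triangle_ineq[of "\<lambda>i. x $ i" "\<lambda>i. y $ i" "{..<n}"]
    by (simp add: norm2_vec_L2_set)
qed

lemma norm2_vec_diff_le:
  assumes "x \<in> carrier_vec n" "y \<in> carrier_vec n"
  shows "norm2_vec (x - y) \<le> norm2_vec x + norm2_vec y"
proof -
  have "x - y = x + (-1) \<cdot>\<^sub>v y" using assms by auto
  then show ?thesis
    using norm2_vec_triangle[of x n "(-1) \<cdot>\<^sub>v y"] assms by (simp add: norm2_vec_smult)
qed

lemma norm2_vec_mult_le_rows:
  "x \<in> carrier_vec (dim_col A) \<Longrightarrow>
    norm2_vec (A *\<^sub>v x) \<le> (\<Sum>i<dim_row A. norm2_vec (row A i)) * norm2_vec x"
proof -
  assume x: "x \<in> carrier_vec (dim_col A)"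
  have "norm2_vec (A *\<^sub>v x) \<le> (\<Sum>i<dim_row A. \<bar>(A *\<^sub>v x) $ i\<bar>)"
    unfolding norm2_vec_L2_set by (rule order_trans[OF L2_set_le_sum_abs]) simp
  also have "\<dots> \<le> (\<Sum>i<dim_row A. norm2_vec (row A i) * norm2_vec x)"
    using x by (intro sum_mono) (auto intro!: norm2_vec_Cauchy_Schwarz)
  finally show ?thesis by (simp add: sum_distrib_right)
qed

text \<open>This makes the supremum in the definition of the operator norm an actual upper bound of the
  set.\<close>

lemma norm2_mat_bdd:
  "bdd_above {norm2_vec (A *\<^sub>v x) | x. x \<in> carrier_vec (dim_col A) \<and> norm2_vec x \<le> 1}"
proof (rule bdd_aboveI, safe)
  fix x assume x: "x \<in> carrier_vec (dim_col A)" "norm2_vec x \<le> 1"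
  show "norm2_vec (A *\<^sub>v x) \<le> (\<Sum>i<dim_row A. norm2_vec (row A i))"
    using norm2_vec_mult_le_rows[OF x(1)] x(2)
    by (meson mult_left_le norm2_vec_nonneg order.trans sum_nonneg)
qed

lemma norm2_mat_nonneg: "0 \<le> norm2_mat A"
  unfolding norm2_mat_def
proof (rule order_trans[OF norm2_vec_nonneg cSup_upper[OF _ norm2_mat_bdd]], intro CollectI exI conjI)
  show "norm2_vec (0\<^sub>v (dim_col A)) \<le> 1" by (simp add: norm2_vec_def)
qed auto

lemma norm2_mat_mult_le:
  assumes x: "x \<in> carrier_vec (dim_col A)"
  shows "norm2_vec (A *\<^sub>v x) \<le> norm2_mat A * norm2_vec x"
proof (cases "norm2_vec x = 0")
  case True
  then show ?thesis using norm2_vec_mult_le_rows[OF x] by simp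
next
  case False
  define c where "c = norm2_vec x"
  have c: "0 < c" using False norm2_vec_nonneg[of x] by (simp add: c_def)
  have "norm2_vec (A *\<^sub>v ((1 / c) \<cdot>\<^sub>v x)) \<le> norm2_mat A"
    unfolding norm2_mat_def
  proof (rule cSup_upper[OF _ norm2_mat_bdd], intro CollectI exI conjI)
    show "norm2_vec ((1 / c) \<cdot>\<^sub>v x) \<le> 1"
      using c by (simp add: norm2_vec_smult) (simp add: c_def)
  qed (use x in auto)
  moreover have "A *\<^sub>v ((1 / c) \<cdot>\<^sub>v x) = (1 / c) \<cdot>\<^sub>v (A *\<^sub>v x)"
    using x by (intro mult_mat_vec[of _ "dim_row A" "dim_col A"]) auto
  ultimately show ?thesis
    using c by (simp add: norm2_vec_smult field_simps c_def)
qed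

lemma norm2_mat_mult_bound:
  assumes "A \<in> carrier_mat r c" "norm2_mat A \<le> a" "x \<in> carrier_vec c"
  shows "norm2_vec (A *\<^sub>v x) \<le> a * norm2_vec x"
  using norm2_mat_mult_le[of x A] assms mult_right_mono[OF assms(2) norm2_vec_nonneg[of x]] by simp

lemma col_diff:
  fixes A B :: "'a :: ab_group_add mat"
  assumes "A \<in> carrier_mat r c" "B \<in> carrier_mat r c" "l < c"
  shows "col (A - B) l = col A l - col B l"
  using assms by (intro eq_vecI) auto

lemma norm2_vec_col_le:
  assumes "A \<in> carrier_mat r c" "\<And>x. x \<in> carrier_vec c \<Longrightarrow> norm2_vec (A *\<^sub>v x) \<le> a * norm2_vec x" "j < c"
  shows "norm2_vec (col A j) \<le> a"
proof -
  have "A *\<^sub>v unit_vec c j = col A j" using assms(1,3) by (intro eq_vecI) auto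
  then show ?thesis using assms(2)[of "unit_vec c j"] assms(3) by (simp add: norm2_vec_unit)
qed

section \<open>Matrices with orthonormal columns\<close>

lemma orthonormal_cols_norm:
  assumes Q: "Q \<in> carrier_mat r n" "transpose_mat Q * Q = 1\<^sub>m n" and x: "x \<in> carrier_vec n"
  shows "norm2_vec (Q *\<^sub>v x) = norm2_vec x"
proof -
  have "(Q *\<^sub>v x) \<bullet> (Q *\<^sub>v x) = (transpose_mat Q *\<^sub>v (Q *\<^sub>v x)) \<bullet> x"
    using Q x by (metis mult_mat_vec_carrier transpose_vec_mult_scalar)
  also have "transpose_mat Q *\<^sub>v (Q *\<^sub>v x) = x"
    using Q x assoc_mult_mat_vec[of "transpose_mat Q" n r Q n x] by simp
  finally show ?thesis by (simp add: norm2_vec_def)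
qed

text \<open>Pythagoras for the orthogonal decomposition of \<open>x\<close> into its projection onto the range of
  \<open>Q\<close>, which has the length of \<open>Q\<^sup>T x\<close>, and the remainder.\<close>

lemma orthonormal_cols_complement:
  assumes Q: "Q \<in> carrier_mat r n" "transpose_mat Q * Q = 1\<^sub>m n" and x: "x \<in> carrier_vec r"
  shows "(norm2_vec (x - Q *\<^sub>v (transpose_mat Q *\<^sub>v x)))\<^sup>2
    = (norm2_vec x)\<^sup>2 - (norm2_vec (transpose_mat Q *\<^sub>v x))\<^sup>2"
proof -
  define y where "y = transpose_mat Q *\<^sub>v x"
  have y: "y \<in> carrier_vec n" using Q x unfolding y_def by (metis mult_mat_vec_carrier transpose_carrier_mat)
  have Qy: "Q *\<^sub>v y \<in> carrier_vec r" using Q y by simp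
  have 1: "(Q *\<^sub>v y) \<bullet> x = y \<bullet> y"
    using Q x y transpose_vec_mult_scalar[of Q r n y x]
    unfolding y_def by (metis comm_scalar_prod mult_mat_vec_carrier)
  have 2: "(Q *\<^sub>v y) \<bullet> (Q *\<^sub>v y) = y \<bullet> y"
    using orthonormal_cols_norm[OF Q y] by (metis norm2_vec_sq)
  have "(x - Q *\<^sub>v y) \<bullet> (x - Q *\<^sub>v y) = x \<bullet> x - 2 * ((Q *\<^sub>v y) \<bullet> x) + (Q *\<^sub>v y) \<bullet> (Q *\<^sub>v y)"
    using x Qy comm_scalar_prod[OF x Qy]
    by (simp add: minus_scalar_prod_distrib[of _ r] scalar_prod_minus_distrib[of _ r])
  then show ?thesis using 1 2 by (simp add: norm2_vec_sq y_def)
qed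

lemma orthonormal_cols_transpose_norm_le:
  assumes Q: "Q \<in> carrier_mat r n" "transpose_mat Q * Q = 1\<^sub>m n" and x: "x \<in> carrier_vec r"
  shows "norm2_vec (transpose_mat Q *\<^sub>v x) \<le> norm2_vec x"
proof -
  have "(norm2_vec (transpose_mat Q *\<^sub>v x))\<^sup>2 \<le> (norm2_vec x)\<^sup>2"
    using orthonormal_cols_complement[OF assms]
    by (metis diff_ge_0_iff_ge zero_le_power2)
  then show ?thesis by (rule power2_le_imp_le[OF _ norm2_vec_nonneg])
qed

lemma norm2_vec_col_orthonormal:
  assumes "Q \<in> carrier_mat r n" "transpose_mat Q * Q = 1\<^sub>m n" "j < n"
  shows "norm2_vec (col Q j) = 1"
proof -
  have "col Q j \<bullet> col Q j = (transpose_mat Q * Q) $$ (j, j)"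
    using assms(1,3) by simp
  then show ?thesis using assms(2,3) by (simp add: norm2_vec_def)
qed

lemma transpose_mult_index_le:
  assumes "A \<in> carrier_mat r a" "B \<in> carrier_mat r b" "i < a" "j < b"
    "norm2_vec (col A i) = 1" "norm2_vec (col B j) \<le> e"
  shows "\<bar>(transpose_mat A * B) $$ (i, j)\<bar> \<le> e"
  using norm2_vec_Cauchy_Schwarz[of "col A i" r "col B j"] assms by simp

text \<open>The projector onto the orthogonal complement of the range of \<open>Q\<close> annihilates \<open>Q c\<close>, so it
  maps \<open>x\<close> and \<open>- h\<close> to the same vector, and it does not increase lengths.\<close>

lemma range_projection_residual_le:
  assumes Q: "Q \<in> carrier_mat r n" "transpose_mat Q * Q = 1\<^sub>m n"
    and c: "c \<in> carrier_vec n" and h: "h \<in> carrier_vec r"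
    and x: "Q *\<^sub>v c = x + h" and x': "x \<in> carrier_vec r"
  shows "norm2_vec (x - Q *\<^sub>v (transpose_mat Q *\<^sub>v x)) \<le> norm2_vec h"
proof -
  have xe: "x = Q *\<^sub>v c - h" unfolding x using x' h by auto
  have Qt: "transpose_mat Q \<in> carrier_mat n r" using Q by simp
  have Qth: "transpose_mat Q *\<^sub>v h \<in> carrier_vec n" using Qt h by (rule mult_mat_vec_carrier)
  have Qc: "Q *\<^sub>v c \<in> carrier_vec r" using Q c by simp
  have "transpose_mat Q *\<^sub>v x = transpose_mat Q *\<^sub>v (Q *\<^sub>v c) - transpose_mat Q *\<^sub>v h"
    unfolding xe by (rule mult_minus_distrib_mat_vec[OF Qt Qc h])
  also have "transpose_mat Q *\<^sub>v (Q *\<^sub>v c) = c"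
    using Q c assoc_mult_mat_vec[OF Qt Q(1) c] by simp
  finally have "Q *\<^sub>v (transpose_mat Q *\<^sub>v x) = Q *\<^sub>v c - Q *\<^sub>v (transpose_mat Q *\<^sub>v h)"
    using mult_minus_distrib_mat_vec[OF Q(1) c Qth] by simp
  then have "x - Q *\<^sub>v (transpose_mat Q *\<^sub>v x) = (-1) \<cdot>\<^sub>v (h - Q *\<^sub>v (transpose_mat Q *\<^sub>v h))"
    unfolding xe using Q Qth Qc h by (intro eq_vecI) auto
  then have "norm2_vec (x - Q *\<^sub>v (transpose_mat Q *\<^sub>v x)) = norm2_vec (h - Q *\<^sub>v (transpose_mat Q *\<^sub>v h))"
    by (simp add: norm2_vec_smult)
  also have "(norm2_vec (h - Q *\<^sub>v (transpose_mat Q *\<^sub>v h)))\<^sup>2 \<le> (norm2_vec h)\<^sup>2"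
    unfolding orthonormal_cols_complement[OF Q h] by simp
  then have "norm2_vec (h - Q *\<^sub>v (transpose_mat Q *\<^sub>v h)) \<le> norm2_vec h"
    by (rule power2_le_imp_le[OF _ norm2_vec_nonneg])
  finally show ?thesis .
qed

text \<open>The left-hand side of the relation has its columns in the range of \<open>Q\<close>. Multiplying by
  \<open>Tinv\<close> shows that \<open>V\<close> itself differs from such a matrix only by \<open>G * Tinv\<close>. For the
  process this is the step where the norm of the inverse of the bidiagonal matrix enters.\<close>

lemma near_range_of_perturbed_projection:
  assumes Q: "Q \<in> carrier_mat r n" "transpose_mat Q * Q = 1\<^sub>m n"
    and c: "V \<in> carrier_mat r k" "Y \<in> carrier_mat r k" "G \<in> carrier_mat r k"
      "T \<in> carrier_mat k k" "Tinv \<in> carrier_mat k k"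
    and inv: "T * Tinv = 1\<^sub>m k"
    and eq: "Q * transpose_mat Q * Y = V * T + G"
    and G: "\<And>x. x \<in> carrier_vec k \<Longrightarrow> norm2_vec (G *\<^sub>v x) \<le> g * norm2_vec x" and g: "0 \<le> g"
    and j: "j < k"
  shows "norm2_vec (col V j - Q *\<^sub>v (transpose_mat Q *\<^sub>v col V j)) \<le> g * norm2_mat Tinv"
proof -
  define z where "z = Tinv *\<^sub>v unit_vec k j"
  have z: "z \<in> carrier_vec k" using c by (simp add: z_def)
  have nz: "norm2_vec z \<le> norm2_mat Tinv"
    using norm2_mat_mult_le[of "unit_vec k j" Tinv] c j by (simp add: z_def norm2_vec_unit)
  have Tz: "T *\<^sub>v z = unit_vec k j"
    unfolding z_def using c inv by (simp flip: assoc_mult_mat_vec)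
  have Vz: "V *\<^sub>v (T *\<^sub>v z) = col V j"
    unfolding Tz using c(1) j by (intro eq_vecI) auto
  have Qt: "transpose_mat Q \<in> carrier_mat n r" using Q by simp
  have Yz: "Y *\<^sub>v z \<in> carrier_vec r" using c z by simp
  have "(Q * transpose_mat Q * Y) *\<^sub>v z = Q *\<^sub>v (transpose_mat Q *\<^sub>v (Y *\<^sub>v z))"
    using assoc_mult_mat_vec[OF mult_carrier_mat[OF Q(1) Qt] c(2) z]
      assoc_mult_mat_vec[OF Q(1) Qt Yz] by (simp del: assoc_mult_mat)
  moreover have "(V * T + G) *\<^sub>v z = col V j + G *\<^sub>v z"
    using c z Vz by (simp add: add_mult_distrib_mat_vec[of _ r k] assoc_mult_mat_vec[of V r k T k z])
  ultimately have "Q *\<^sub>v (transpose_mat Q *\<^sub>v (Y *\<^sub>v z)) = col V j + G *\<^sub>v z"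
    using eq by simp
  from range_projection_residual_le[OF Q _ _ this]
  have "norm2_vec (col V j - Q *\<^sub>v (transpose_mat Q *\<^sub>v col V j)) \<le> norm2_vec (G *\<^sub>v z)"
    using mult_mat_vec_carrier[OF Qt Yz] c z j by auto
  also have "\<dots> \<le> g * norm2_vec z" using G z by blast
  also have "\<dots> \<le> g * norm2_mat Tinv" using nz g by (rule mult_left_mono)
  finally show ?thesis .
qed

section \<open>Triangular systems and nearly orthonormal columns\<close>

text \<open>Perturbed forward substitution. The numbers \<open>x l\<close> satisfy a triangular system whose right-hand
  side is zero up to an error \<open>b\<close>, except for \<open>c\<close> in the last equation. Each \<open>x j\<close> is then
  bounded by \<open>b\<close> plus the sum of its predecessors, times the factor 2 from dividing by the diagonal
  entry, so the unknowns before the last one stay of order \<open>b\<close>. The last diagonal entry is not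
  divided out, because it is needed exactly.\<close>

lemma forward_substitution:
  fixes x :: "nat \<Rightarrow> real" and T :: "nat \<Rightarrow> nat \<Rightarrow> real"
  assumes T: "\<And>l j. l < j \<Longrightarrow> j \<le> j0 \<Longrightarrow> \<bar>T l j\<bar> \<le> 1"
    and diag: "\<And>j. j < j0 \<Longrightarrow> 1 / 2 \<le> T j j"
    and eq: "\<And>j. j \<le> j0 \<Longrightarrow> \<bar>(\<Sum>l\<le>j. x l * T l j) - (if j = j0 then c else 0)\<bar> \<le> b"
  shows "j < j0 \<Longrightarrow> \<bar>x j\<bar> \<le> 2 * b * 3 ^ j"
    and "\<bar>x j0 * T j0 j0 - c\<bar> \<le> b * 3 ^ j0"
proof -
  have tail: "\<bar>x j * T j j - (if j = j0 then c else 0)\<bar> \<le> b + (\<Sum>l<j. \<bar>x l\<bar>)" if "j \<le> j0" for j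
  proof -
    have "\<bar>\<Sum>l<j. x l * T l j\<bar> \<le> (\<Sum>l<j. \<bar>x l\<bar> * \<bar>T l j\<bar>)"
      by (simp flip: abs_mult)
    also have "\<dots> \<le> (\<Sum>l<j. \<bar>x l\<bar>)"
      using T that by (intro sum_mono mult_left_le) auto
    finally show ?thesis using eq[OF that] by (simp add: lessThan_Suc_atMost[symmetric])
  qed
  \<comment> \<open>The bounds \<open>2 * b * 3 ^ l\<close> solve the recursion \<open>y j = 2 * (b + (\<Sum>l<j. y l))\<close>.\<close>
  have geom: "b + (\<Sum>l<j. 2 * b * 3 ^ l) = b * 3 ^ j" for j
    by (induction j) auto
  have main: "\<bar>x j\<bar> \<le> 2 * b * 3 ^ j" if "j < j0" for j
    using that
  proof (induction j rule: less_induct)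
    case (less j)
    have "(\<Sum>l<j. \<bar>x l\<bar>) \<le> (\<Sum>l<j. 2 * b * 3 ^ l)"
      using less by (intro sum_mono) auto
    then have "\<bar>x j * T j j\<bar> \<le> b * 3 ^ j"
      using tail[of j] geom[of j] less.prems by simp
    moreover have "\<bar>x j\<bar> * (1 / 2) \<le> \<bar>x j * T j j\<bar>"
      unfolding abs_mult using diag[OF less.prems] by (intro mult_left_mono) auto
    ultimately show ?case by simp
  qed
  then show "j < j0 \<Longrightarrow> \<bar>x j\<bar> \<le> 2 * b * 3 ^ j" .
  have "(\<Sum>l<j0. \<bar>x l\<bar>) \<le> (\<Sum>l<j0. 2 * b * 3 ^ l)"
    using main by (intro sum_mono) auto
  then show "\<bar>x j0 * T j0 j0 - c\<bar> \<le> b * 3 ^ j0"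
    using tail[of j0] geom[of j0] by simp
qed

text \<open>The entries of \<open>T\<close> are those of a Cholesky factor of a Gram matrix with unit-like diagonal and
  off-diagonal entries of size \<open>\<mu>\<close>. Forward substitution shows that the off-diagonal entries of
  \<open>T\<close> are of order \<open>\<mu>\<close>. The diagonal entries are better: only the squares of the
  off-diagonal entries are subtracted from the diagonal of the Gram matrix, so they deviate from 1
  by \<open>d\<close> plus order \<open>\<mu>\<^sup>2\<close>. This is why semiorthogonality at the level \<open>sqrt \<delta>\<close> suffices for an error of
  order \<open>\<delta>\<close>.\<close>

lemma gram_factor_near_identity:
  fixes T :: "nat \<Rightarrow> nat \<Rightarrow> real"
  assumes pos: "\<And>j. j < r \<Longrightarrow> 0 < T j j"
    and diag: "\<And>j. j < r \<Longrightarrow> 1 - d \<le> (\<Sum>l\<le>j. T l j * T l j) \<and> (\<Sum>l\<le>j. T l j * T l j) \<le> 1"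
    and off: "\<And>i j. i < j \<Longrightarrow> j < r \<Longrightarrow> \<bar>\<Sum>l\<le>i. T l j * T l i\<bar> \<le> \<mu>"
    and \<mu>: "0 \<le> \<mu>" and small: "d + \<mu>\<^sup>2 * 9 ^ r \<le> 1 / 2"
  shows "l \<le> j \<Longrightarrow> j < r \<Longrightarrow> \<bar>T l j\<bar> \<le> 1"
    and "j < r \<Longrightarrow> 1 - (d + \<mu>\<^sup>2 * 9 ^ r) \<le> T j j"
proof -
  have le1: "\<bar>T l j\<bar> \<le> 1" if "l \<le> j" "j < r" for l j
  proof -
    have "T l j * T l j \<le> (\<Sum>l\<le>j. T l j * T l j)"
      using that by (intro member_le_sum) auto
    then have "(T l j)\<^sup>2 \<le> 1" using diag[of j] that by (simp add: power2_eq_square)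
    then show ?thesis by (simp add: abs_square_le_1)
  qed
  then show "l \<le> j \<Longrightarrow> j < r \<Longrightarrow> \<bar>T l j\<bar> \<le> 1" .
  have lower: "1 - (d + \<mu>\<^sup>2 * 9 ^ r) \<le> T j j" if "j < r" for j
    using that
  proof (induction j rule: less_induct)
    case (less j)
    have "\<bar>T l j\<bar> \<le> 2 * \<mu> * 3 ^ l" if "l < j" for l
    proof (rule forward_substitution(1)[where T = T and c = "\<Sum>l\<le>j. T l j * T l j"])
      show "1 / 2 \<le> T i i" if "i < j" for i
        using less.IH[OF that] less.prems that small by linarith
      show "\<bar>(\<Sum>l\<le>i. T l j * T l i) - (if i = j then \<Sum>l\<le>j. T l j * T l j else 0)\<bar> \<le> \<mu>"
        if "i \<le> j" for i
        using off[of i j] less.prems that \<mu> by auto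
    qed (use le1 less.prems that in auto)
    then have sq: "T l j * T l j \<le> (2 * \<mu> * 3 ^ l)\<^sup>2" if "l < j" for l
      using power_mono[of "\<bar>T l j\<bar>" "2 * \<mu> * 3 ^ l" 2] that
      unfolding power2_eq_square[of "T l j", symmetric] by simp
    have "(\<Sum>l<j. T l j * T l j) \<le> (\<Sum>l<j. (2 * \<mu> * 3 ^ l)\<^sup>2)"
      by (rule sum_mono) (use sq in simp)
    also have "\<dots> = \<mu>\<^sup>2 / 2 * (9 ^ j - 1)"
    proof (induction j)
      case (Suc j)
      have "((3 :: real) ^ j)\<^sup>2 = 9 ^ j"
        by (simp add: power2_eq_square flip: power_mult_distrib)
      then show ?case using Suc by (simp add: power_mult_distrib algebra_simps)
    qed simp
    also have "\<dots> \<le> \<mu>\<^sup>2 * 9 ^ r"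
    proof -
      have "(9 :: real) ^ j - 1 \<le> 9 ^ r"
        using power_increasing[of j r "9 :: real"] less.prems by linarith
      then have "\<mu>\<^sup>2 * (9 ^ j - 1) \<le> \<mu>\<^sup>2 * 9 ^ r"
        by (intro mult_left_mono) simp_all
      moreover have "0 \<le> \<mu>\<^sup>2 * 9 ^ r" by simp
      ultimately show ?thesis by linarith
    qed
    finally have "1 - (d + \<mu>\<^sup>2 * 9 ^ r) \<le> T j j * T j j"
      using diag[OF less.prems] by (simp add: lessThan_Suc_atMost[symmetric])
    also have "\<dots> \<le> T j j"
      using le1[of j j] pos[OF less.prems] less.prems by (simp add: mult_left_le)
    finally show ?case .
  qed
  then show "j < r \<Longrightarrow> 1 - (d + \<mu>\<^sup>2 * 9 ^ r) \<le> T j j" .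
qed

lemma upper_triangular_mult_index:
  fixes X T :: "'a :: comm_ring_1 mat"
  assumes "X \<in> carrier_mat a r" "T \<in> carrier_mat r r" "upper_triangular T" "i < a" "j < r"
  shows "(X * T) $$ (i, j) = (\<Sum>l\<le>j. X $$ (i, l) * T $$ (l, j))"
proof -
  have "(X * T) $$ (i, j) = (\<Sum>l<r. X $$ (i, l) * T $$ (l, j))"
    using assms by (simp add: scalar_prod_def lessThan_atLeast0)
  also have "\<dots> = (\<Sum>l\<le>j. X $$ (i, l) * T $$ (l, j))"
    using assms by (intro sum.mono_neutral_right) (auto simp: upper_triangular_def)
  finally show ?thesis .
qed

lemma abs_col_scalar_prod_le_xi:
  assumes "i < dim_col W" "l < dim_col W" "i \<noteq> l"
  shows "\<bar>col W i \<bullet> col W l\<bar> \<le> xi W"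
proof -
  have "{\<bar>col W i \<bullet> col W l\<bar> | i l. i < dim_col W \<and> l < dim_col W \<and> i \<noteq> l}
      \<subseteq> (\<lambda>(i, l). \<bar>col W i \<bullet> col W l\<bar>) ` ({..<dim_col W} \<times> {..<dim_col W})"
    by auto
  then have "finite {\<bar>col W i \<bullet> col W l\<bar> | i l. i < dim_col W \<and> l < dim_col W \<and> i \<noteq> l}"
    by (rule finite_subset) simp
  then show ?thesis
    unfolding xi_def by (intro Max_ge) (use assms in auto)
qed

lemma compact_qrD:
  assumes "compact_qr W Q R"
  shows "Q \<in> carrier_mat (dim_row W) (dim_col W)" "R \<in> carrier_mat (dim_col W) (dim_col W)"
    "transpose_mat Q * Q = 1\<^sub>m (dim_col W)" "upper_triangular R" "W = Q * R"
  using assms unfolding compact_qr_def by blast+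

text \<open>The triangular factor of a QR factorization of \<open>W\<close> is a Cholesky factor of the Gram matrix of the
  columns of \<open>W\<close>, since the orthonormal factor cancels in \<open>W\<^sup>T W\<close>.\<close>

lemma compact_qr_factor_near_identity:
  assumes qr: "compact_qr W Q T" "pos_diag T"
    and diag: "\<And>j. j < dim_col W \<Longrightarrow> 1 - d \<le> (norm2_vec (col W j))\<^sup>2 \<and> (norm2_vec (col W j))\<^sup>2 \<le> 1"
    and \<mu>: "xi W \<le> \<mu>" "0 \<le> \<mu>" and small: "d + \<mu>\<^sup>2 * 9 ^ dim_col W \<le> 1 / 2"
  shows "l \<le> j \<Longrightarrow> j < dim_col W \<Longrightarrow> \<bar>T $$ (l, j)\<bar> \<le> 1"
    and "j < dim_col W \<Longrightarrow> 1 - (d + \<mu>\<^sup>2 * 9 ^ dim_col W) \<le> T $$ (j, j)"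
proof -
  define r where "r = dim_col W"
  note c = compact_qrD[OF qr(1), folded r_def]
  have WW: "transpose_mat W * W = transpose_mat T * T"
  proof -
    have Tt: "transpose_mat T \<in> carrier_mat r r" and Qt: "transpose_mat Q \<in> carrier_mat r (dim_row W)"
      using c(1,2) by auto
    have "transpose_mat W * W = transpose_mat (Q * T) * (Q * T)" by (rule arg_cong[OF c(5)])
    also have "\<dots> = transpose_mat T * transpose_mat Q * (Q * T)"
      by (simp only: transpose_mult[OF c(1,2)])
    also have "\<dots> = transpose_mat T * (transpose_mat Q * (Q * T))"
      by (rule assoc_mult_mat[OF Tt Qt mult_carrier_mat[OF c(1,2)]])
    also have "transpose_mat Q * (Q * T) = transpose_mat Q * Q * T"
      by (rule assoc_mult_mat[OF Qt c(1,2), symmetric])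
    finally show ?thesis using left_mult_one_mat[OF c(2)] by (simp only: c(3))
  qed
  have gram: "(\<Sum>l\<le>i. T $$ (l, j) * T $$ (l, i)) = col W j \<bullet> col W i" if "i \<le> j" "j < r" for i j
  proof -
    have "col W j \<bullet> col W i = (transpose_mat W * W) $$ (j, i)"
      using that by (simp add: r_def)
    also have "\<dots> = (\<Sum>l\<le>i. T $$ (l, j) * T $$ (l, i))"
      unfolding WW using upper_triangular_mult_index[of "transpose_mat T" r r T j i] c(2,4) that by simp
    finally show ?thesis by simp
  qed
  have 1: "0 < T $$ (j, j)" if "j < r" for j using qr(2) c(2) that by (simp add: pos_diag_def)
  have 2: "1 - d \<le> (\<Sum>l\<le>j. T $$ (l, j) * T $$ (l, j)) \<and> (\<Sum>l\<le>j. T $$ (l, j) * T $$ (l, j)) \<le> 1"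
    if "j < r" for j
    using gram[of j j] diag[of j] that by (simp add: norm2_vec_sq r_def)
  have 3: "\<bar>\<Sum>l\<le>i. T $$ (l, j) * T $$ (l, i)\<bar> \<le> \<mu>" if "i < j" "j < r" for i j
    using gram[of i j] abs_col_scalar_prod_le_xi[of j W i] \<mu>(1) that by (simp add: r_def)
  note res = gram_factor_near_identity[where T = "\<lambda>i j. T $$ (i, j)", OF 1 2 3 \<mu>(2) small[folded r_def]]
  show "l \<le> j \<Longrightarrow> j < dim_col W \<Longrightarrow> \<bar>T $$ (l, j)\<bar> \<le> 1"
    using res(1) by (simp add: r_def)
  show "j < dim_col W \<Longrightarrow> 1 - (d + \<mu>\<^sup>2 * 9 ^ dim_col W) \<le> T $$ (j, j)"
    using res(2) by (simp add: r_def)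
qed

section \<open>Bidiagonal matrices\<close>

lemma mult_bidiag_index:
  assumes "X \<in> carrier_mat a (k + 1)" "i < a" "j < k"
  shows "(X * bidiag \<alpha> \<beta> k) $$ (i, j) = X $$ (i, j) * \<alpha> (j + 1) + X $$ (i, j + 1) * \<beta> (j + 2)"
proof -
  have "(X * bidiag \<alpha> \<beta> k) $$ (i, j) =
      (\<Sum>l<k + 1. X $$ (i, l) * (if l = j then \<alpha> (j + 1) else if l = j + 1 then \<beta> (j + 2) else 0))"
    using assms by (simp add: bidiag_def scalar_prod_def lessThan_atLeast0)
  also have "\<dots> = (\<Sum>l\<in>{j, j + 1}. X $$ (i, l) * (if l = j then \<alpha> (j + 1) else if l = j + 1 then \<beta> (j + 2) else 0))"
    using assms by (intro sum.mono_neutral_right) auto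
  finally show ?thesis by simp
qed

lemma upper_triangular_mult_bidiag_upper_index:
  assumes "T \<in> carrier_mat k k" "upper_triangular T" "i \<le> j" "j < k"
  shows "(T * bidiag_upper \<alpha> \<beta> k) $$ (j, i) = (if i = j then T $$ (j, j) * \<alpha> (j + 1) else 0)"
proof -
  have "(T * bidiag_upper \<alpha> \<beta> k) $$ (j, i) =
      (\<Sum>l<k. T $$ (j, l) * (if l = i then \<alpha> (i + 1) else if i = l + 1 then \<beta> (i + 1) else 0))"
    using assms by (simp add: bidiag_upper_def scalar_prod_def lessThan_atLeast0)
  also have "\<dots> = (\<Sum>l<k. if l = j then (if i = j then T $$ (j, j) * \<alpha> (j + 1) else 0) else 0)"
    using assms by (intro sum.cong) (auto simp: upper_triangular_def)
  finally show ?thesis using assms by simp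
qed

text \<open>Used with \<open>r\<close> and \<open>s\<close> two diagonal entries close to 1: then \<open>x\<close>, which is nearly
  \<open>\<gamma> * r / s\<close>, is close to \<open>\<gamma>\<close>.\<close>

lemma ratio_perturbation:
  fixes x \<gamma> r s :: real
  assumes "\<bar>x * s - \<gamma> * r\<bar> \<le> e" "1 / 2 \<le> s" "\<bar>r - s\<bar> \<le> t" "\<bar>\<gamma>\<bar> \<le> g"
  shows "\<bar>x - \<gamma>\<bar> \<le> 2 * (e + g * t)"
proof -
  have "\<bar>x - \<gamma>\<bar> * s = \<bar>(x * s - \<gamma> * r) + \<gamma> * (r - s)\<bar>"
    using assms(2) by (simp add: abs_mult_pos' algebra_simps)
  also have "\<dots> \<le> e + g * t"
  proof -
    have "\<bar>\<gamma> * (r - s)\<bar> \<le> g * t"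
      unfolding abs_mult using assms by (intro mult_mono) auto
    then show ?thesis using assms(1) by linarith
  qed
  finally have 1: "\<bar>x - \<gamma>\<bar> * s \<le> e + g * t" .
  have "\<bar>x - \<gamma>\<bar> * (1 / 2) \<le> \<bar>x - \<gamma>\<bar> * s"
    using assms(2) by (intro mult_left_mono) auto
  then show ?thesis using 1 by simp
qed

text \<open>The core of the argument. The product \<open>R * bidiag \<alpha> \<beta> k\<close> is upper Hessenberg, so the first
  relation determines the part of \<open>X\<close> below the diagonal: it is small left of the subdiagonal, and on
  the subdiagonal it is \<open>\<beta>\<close> times a quotient of diagonal entries of \<open>R\<close> and \<open>S\<close>. The product
  \<open>S * bidiag_upper \<alpha> \<beta> k\<close> is upper triangular, so the second relation in the same way determines
  the rest of \<open>X\<close>: small above the diagonal, and on the diagonal \<open>\<alpha>\<close> times a quotient of diagonal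
  entries of \<open>S\<close> and \<open>R\<close>. Only diagonal entries of \<open>R\<close> and \<open>S\<close> appear in these quotients,
  which is essential: in the application the strict upper triangles of \<open>R\<close> and \<open>S\<close> are merely of
  order \<open>sqrt \<delta>\<close>, and either relation alone would let them into the error.\<close>

lemma bidiagonal_from_triangular_relations:
  fixes X S R :: "real mat"
  assumes X: "X \<in> carrier_mat (k + 1) k"
    and S: "S \<in> carrier_mat k k" "upper_triangular S"
    and R: "R \<in> carrier_mat (k + 1) (k + 1)" "upper_triangular R"
    and S1: "\<And>l j. l \<le> j \<Longrightarrow> j < k \<Longrightarrow> \<bar>S $$ (l, j)\<bar> \<le> 1" "\<And>j. j < k \<Longrightarrow> 1 - t \<le> S $$ (j, j)"
    and R1: "\<And>l j. l \<le> j \<Longrightarrow> j < k + 1 \<Longrightarrow> \<bar>R $$ (l, j)\<bar> \<le> 1" "\<And>j. j < k + 1 \<Longrightarrow> 1 - t \<le> R $$ (j, j)"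
    and t: "t \<le> 1 / 2"
    and XS: "\<And>i j. i < k + 1 \<Longrightarrow> j < k \<Longrightarrow> \<bar>(X * S) $$ (i, j) - (R * bidiag \<alpha> \<beta> k) $$ (i, j)\<bar> \<le> b"
    and XR: "\<And>i j. i < k \<Longrightarrow> j < k \<Longrightarrow>
      \<bar>(transpose_mat X * R) $$ (j, i) - (S * bidiag_upper \<alpha> \<beta> k) $$ (j, i)\<bar> \<le> b"
    and ab: "\<And>i. 1 \<le> i \<Longrightarrow> i \<le> k \<Longrightarrow> \<bar>\<alpha> i\<bar> \<le> g \<and> \<bar>\<beta> (i + 1)\<bar> \<le> g"
    and ij: "i < k + 1" "j < k"
  shows "\<bar>X $$ (i, j) - bidiag \<alpha> \<beta> k $$ (i, j)\<bar> \<le> 2 * (b * 3 ^ k + g * t)"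
proof -
  have b: "0 \<le> b" using XS[OF ij] by linarith
  have g: "0 \<le> g" using ab[of 1] ij by fastforce
  have t0: "0 \<le> t" using S1(1)[of j j] S1(2)[of j] ij by fastforce
  have pow: "b * 3 ^ l \<le> b * 3 ^ k" if "l \<le> k" for l
    using b that by (intro mult_left_mono power_increasing) auto
  have half: "1 / 2 \<le> S $$ (l, l)" if "l < k" for l using S1(2)[OF that] t by linarith
  have half': "1 / 2 \<le> R $$ (l, l)" if "l < k + 1" for l using R1(2)[OF that] t by linarith
  have gt: "0 \<le> g * t" using g t0 by simp
  have close: "\<bar>S $$ (l, l) - R $$ (l', l')\<bar> \<le> t" "\<bar>R $$ (l', l') - S $$ (l, l)\<bar> \<le> t"
    if "l < k" "l' < k + 1" for l l'
    using S1(1)[of l l] S1(2)[of l] R1(1)[of l' l'] R1(2)[of l'] that by auto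
  show ?thesis
  proof (cases "j < i")
    case True
    \<comment> \<open>Row \<open>i\<close> of \<open>R * bidiag \<alpha> \<beta> k\<close> vanishes left of column \<open>i - 1\<close>, where its entry is \<open>c\<close>.\<close>
    define c where "c = R $$ (i, i) * \<beta> (i + 1)"
    note fs = forward_substitution[where x = "\<lambda>l. X $$ (i, l)" and T = "\<lambda>l j. S $$ (l, j)"
        and ?j0.0 = "i - 1" and c = c and b = b]
    have eq: "\<bar>(\<Sum>l\<le>j'. X $$ (i, l) * S $$ (l, j')) - (if j' = i - 1 then c else 0)\<bar> \<le> b"
      if "j' \<le> i - 1" for j'
    proof -
      have "(R * bidiag \<alpha> \<beta> k) $$ (i, j') = (if j' = i - 1 then c else 0)"
        using R that True ij
        by (auto simp: mult_bidiag_index[OF R(1) ij(1)] upper_triangular_def c_def)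
      then show ?thesis
        using XS[OF ij(1), of j'] that True ij upper_triangular_mult_index[OF X S ij(1), of j'] by simp
    qed
    show ?thesis
    proof (cases "j = i - 1")
      case False
      then have "\<bar>X $$ (i, j)\<bar> \<le> 2 * b * 3 ^ j"
        using True ij S1(1) half by (intro fs(1) eq) auto
      moreover have "bidiag \<alpha> \<beta> k $$ (i, j) = 0" using True False ij by (auto simp: bidiag_def)
      ultimately show ?thesis using pow[of j] ij gt by simp
    next
      case j: True
      have "\<bar>X $$ (i, i - 1) * S $$ (i - 1, i - 1) - c\<bar> \<le> b * 3 ^ (i - 1)"
        using True ij S1(1) half by (intro fs(2) eq) auto
      then have "\<bar>X $$ (i, j) * S $$ (j, j) - \<beta> (i + 1) * R $$ (i, i)\<bar> \<le> b * 3 ^ k"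
        using pow[of j] ij by (simp add: j c_def mult.commute)
      then have "\<bar>X $$ (i, j) - \<beta> (i + 1)\<bar> \<le> 2 * (b * 3 ^ k + g * t)"
        by (rule ratio_perturbation) (use half close ab[of i] True ij in auto)
      moreover have "bidiag \<alpha> \<beta> k $$ (i, j) = \<beta> (i + 1)" using True ij by (auto simp: bidiag_def j)
      ultimately show ?thesis by simp
    qed
  next
    case False
    \<comment> \<open>Row \<open>j\<close> of \<open>S * bidiag_upper \<alpha> \<beta> k\<close> vanishes left of column \<open>j\<close>, where its entry is \<open>c\<close>.\<close>
    define c where "c = S $$ (j, j) * \<alpha> (j + 1)"
    note fs = forward_substitution[where x = "\<lambda>l. X $$ (l, j)" and T = "\<lambda>l j. R $$ (l, j)"
        and ?j0.0 = j and c = c and b = b]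
    have eq: "\<bar>(\<Sum>l\<le>i'. X $$ (l, j) * R $$ (l, i')) - (if i' = j then c else 0)\<bar> \<le> b"
      if "i' \<le> j" for i'
    proof -
      have "(transpose_mat X * R) $$ (j, i') = (\<Sum>l\<le>i'. X $$ (l, j) * R $$ (l, i'))"
        using upper_triangular_mult_index[OF _ R ij(2), of "transpose_mat X" i'] X that ij by simp
      then show ?thesis
        using XR[of i' j] that ij upper_triangular_mult_bidiag_upper_index[OF S that ij(2)]
        by (auto simp: c_def split: if_splits)
    qed
    show ?thesis
    proof (cases "i = j")
      case False
      then have "\<bar>X $$ (i, j)\<bar> \<le> 2 * b * 3 ^ i"
        using \<open>\<not> j < i\<close> ij R1(1) half' by (intro fs(1) eq) auto
      moreover have "bidiag \<alpha> \<beta> k $$ (i, j) = 0" using \<open>\<not> j < i\<close> False ij by (auto simp: bidiag_def)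
      ultimately show ?thesis using pow[of i] ij gt by simp
    next
      case i: True
      have "\<bar>X $$ (j, j) * R $$ (j, j) - c\<bar> \<le> b * 3 ^ j"
        using ij R1(1) half' by (intro fs(2) eq) auto
      then have "\<bar>X $$ (j, j) * R $$ (j, j) - \<alpha> (j + 1) * S $$ (j, j)\<bar> \<le> b * 3 ^ k"
        using pow[of j] ij by (simp add: c_def mult.commute)
      then have "\<bar>X $$ (j, j) - \<alpha> (j + 1)\<bar> \<le> 2 * (b * 3 ^ k + g * t)"
        by (rule ratio_perturbation) (use half' close ab[of "j + 1"] ij in auto)
      then show ?thesis using ij by (simp add: bidiag_def i)
    qed
  qed
qed

text \<open>Column \<open>j\<close> of the relation reads \<open>\<alpha> u + \<beta> u' = y\<close> for two consecutive unit vectors \<open>u\<close> and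
  \<open>u'\<close> whose inner product is at most 1/2. Its inner products with \<open>u\<close> and \<open>u'\<close> form a strictly
  diagonally dominant 2 by 2 system for the two coefficients.\<close>

lemma bidiag_coefficients_le:
  assumes U: "U \<in> carrier_mat m (k + 1)" "\<And>l. l < k + 1 \<Longrightarrow> norm2_vec (col U l) = 1" "xi U \<le> 1 / 2"
    and Y: "Y \<in> carrier_mat m k" "U * bidiag \<alpha> \<beta> k = Y" "\<And>l. l < k \<Longrightarrow> norm2_vec (col Y l) \<le> 2"
    and i: "1 \<le> i" "i \<le> k"
  shows "\<bar>\<alpha> i\<bar> \<le> 4" "\<bar>\<beta> (i + 1)\<bar> \<le> 4"
proof -
  obtain j where j: "i = j + 1" "j < k" using i by (cases i) auto
  define \<rho> where "\<rho> = (transpose_mat U * U) $$ (j, j + 1)"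
  have UU: "transpose_mat U * U \<in> carrier_mat (k + 1) (k + 1)" using U by simp
  have B: "bidiag \<alpha> \<beta> k \<in> carrier_mat (k + 1) k" by (simp add: bidiag_def)
  have assoc: "transpose_mat U * U * bidiag \<alpha> \<beta> k = transpose_mat U * Y"
    using U B Y(2) by (simp add: assoc_mult_mat[of _ "k + 1" m _ "k + 1" _ k])
  have diag: "(transpose_mat U * U) $$ (l, l) = 1" if "l < k + 1" for l
    using U that norm2_vec_sq[of "col U l"] by simp
  have off: "(transpose_mat U * U) $$ (j + 1, j) = \<rho>"
  proof -
    have "col U l \<in> carrier_vec m" for l using U(1) by auto
    from comm_scalar_prod[OF this this] show ?thesis using U(1) j by (simp add: \<rho>_def)
  qed
  have \<rho>: "\<bar>\<rho>\<bar> \<le> 1 / 2"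
    using abs_col_scalar_prod_le_xi[of j U "j + 1"] U j by (simp add: \<rho>_def)
  have Yb: "\<bar>(transpose_mat U * Y) $$ (l, j)\<bar> \<le> 2" if "l < k + 1" for l
    using transpose_mult_index_le[OF U(1) Y(1) that j(2)] U(2) Y(3) j that by simp
  have "\<bar>\<alpha> i + \<rho> * \<beta> (i + 1)\<bar> \<le> 2"
    using Yb[of j] mult_bidiag_index[OF UU, of j j \<alpha> \<beta>] assoc diag[of j] j by (simp add: \<rho>_def)
  moreover have "\<bar>\<rho> * \<alpha> i + \<beta> (i + 1)\<bar> \<le> 2"
    using Yb[of "j + 1"] mult_bidiag_index[OF UU, of "j + 1" j \<alpha> \<beta>] assoc diag[of "j + 1"] off j by simp
  moreover have "\<bar>\<rho> * x\<bar> \<le> \<bar>x\<bar> / 2" for x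
    using mult_right_mono[OF \<rho>, of "\<bar>x\<bar>"] by (simp add: abs_mult)
  from this[of "\<alpha> i"] this[of "\<beta> (i + 1)"]
  have "\<bar>\<rho> * \<alpha> i\<bar> \<le> \<bar>\<alpha> i\<bar> / 2" "\<bar>\<rho> * \<beta> (i + 1)\<bar> \<le> \<bar>\<beta> (i + 1)\<bar> / 2" by auto
  ultimately show "\<bar>\<alpha> i\<bar> \<le> 4" "\<bar>\<beta> (i + 1)\<bar> \<le> 4" by linarith+
qed

text \<open>The first column of the upper bidiagonal matrix is \<open>\<alpha> 1\<close> times the first unit vector. This lower
  bound is what allows errors of order \<open>\<epsilon>\<close> to be absorbed into \<open>norm2_mat Binv * \<epsilon>\<close>.\<close>

lemma norm2_mat_inverse_bidiag_upper_ge: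
  assumes "Binv \<in> carrier_mat k k" "Binv * bidiag_upper \<alpha> \<beta> k = 1\<^sub>m k" "1 \<le> k"
  shows "1 \<le> norm2_mat Binv * \<bar>\<alpha> 1\<bar>"
proof -
  have T: "bidiag_upper \<alpha> \<beta> k \<in> carrier_mat k k" by (simp add: bidiag_upper_def)
  have "col (bidiag_upper \<alpha> \<beta> k) 0 = \<alpha> 1 \<cdot>\<^sub>v unit_vec k 0"
    using assms(3) by (intro eq_vecI) (auto simp: bidiag_upper_def)
  moreover have "Binv *\<^sub>v col (bidiag_upper \<alpha> \<beta> k) 0 = unit_vec k 0"
    using col_mult2[OF assms(1) T, of 0] assms(2,3) by simp
  ultimately have "norm2_vec (Binv *\<^sub>v (\<alpha> 1 \<cdot>\<^sub>v unit_vec k 0)) = 1"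
    using assms(3) by (simp add: norm2_vec_unit)
  then show ?thesis
    using norm2_mat_mult_le[of "\<alpha> 1 \<cdot>\<^sub>v unit_vec k 0" Binv] assms
    by (simp add: norm2_vec_smult norm2_vec_unit)
qed

section \<open>Rectangular identity matrices\<close>

text \<open>The rectangular identity: \<open>eye m (m + p)\<close> is the block row \<open>(I, 0)\<close>, its transpose appends zero rows,
  and multiplication from the right by \<open>eye (k + 1) k\<close> drops the last column.\<close>

definition eye :: "nat \<Rightarrow> nat \<Rightarrow> real mat" where
  "eye r c = mat r c (\<lambda>(i, j). if i = j then 1 else 0)"

lemma eye_carrier [simp]: "eye r c \<in> carrier_mat r c"
  by (simp add: eye_def)

lemma transpose_eye: "transpose_mat (eye r c) = eye c r"
  by (rule eq_matI) (auto simp: eye_def)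

lemma eye_mult_index:
  assumes "A \<in> carrier_mat c n" "i < r" "j < n"
  shows "(eye r c * A) $$ (i, j) = (if i < c then A $$ (i, j) else 0)"
proof -
  have "(eye r c * A) $$ (i, j) = (\<Sum>l<c. (if i = l then 1 else 0) * A $$ (l, j))"
    using assms by (simp add: eye_def scalar_prod_def lessThan_atLeast0)
  also have "\<dots> = (\<Sum>l<c. if l = i then A $$ (l, j) else 0)"
    by (rule sum.cong) auto
  finally show ?thesis by simp
qed

lemma mult_eye_index:
  assumes "A \<in> carrier_mat n r" "i < n" "j < c"
  shows "(A * eye r c) $$ (i, j) = (if j < r then A $$ (i, j) else 0)"
proof -
  have "(A * eye r c) $$ (i, j) = (\<Sum>l<r. A $$ (i, l) * (if l = j then 1 else 0))"
    using assms by (simp add: eye_def scalar_prod_def lessThan_atLeast0)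
  also have "\<dots> = (\<Sum>l<r. if l = j then A $$ (i, l) else 0)"
    by (rule sum.cong) auto
  finally show ?thesis by simp
qed

lemma eye_mult_eye: "r \<le> c \<Longrightarrow> eye r c * eye c r = 1\<^sub>m r"
  by (rule eq_matI) (auto simp: eye_mult_index[of _ c r] simp del: index_mult_mat(1), auto simp: eye_def)

lemma eye_orthonormal_cols: "c \<le> r \<Longrightarrow> transpose_mat (eye r c) * eye r c = 1\<^sub>m c"
  by (simp add: transpose_eye eye_mult_eye)

lemma four_block_eq_eye: "four_block_mat (1\<^sub>m m) (0\<^sub>m m p) (0\<^sub>m 0 m) (0\<^sub>m 0 p) = eye m (m + p)"
  by (rule eq_matI) (auto simp: eye_def)

lemma eye_mult_append_rows:
  assumes "X \<in> carrier_mat m n" "Y \<in> carrier_mat p n"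
  shows "eye m (m + p) * (X @\<^sub>r Y) = X"
proof (rule eq_matI)
  fix i j assume "i < dim_row X" "j < dim_col X"
  then show "(eye m (m + p) * (X @\<^sub>r Y)) $$ (i, j) = X $$ (i, j)"
    using assms eye_mult_index[of "X @\<^sub>r Y" "m + p" n i m j]
    by (simp del: index_mult_mat(1)) (simp add: append_rows_def)
qed (use assms in auto, simp_all add: eye_def append_rows_def)

lemma append_zero_rows_eq_eye_mult:
  assumes "X \<in> carrier_mat m n"
  shows "X @\<^sub>r 0\<^sub>m p n = eye (m + p) m * X"
proof (rule eq_matI)
  fix i j assume "i < dim_row (eye (m + p) m * X)" "j < dim_col (eye (m + p) m * X)"
  then show "(X @\<^sub>r 0\<^sub>m p n) $$ (i, j) = (eye (m + p) m * X) $$ (i, j)"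
    using assms eye_mult_index[of X m n i "m + p" j]
    by (simp add: eye_def del: index_mult_mat(1)) (auto simp add: append_rows_def)
qed (use assms in \<open>auto simp: eye_def append_rows_def\<close>)

lemma transpose_bidiag_mult_eye:
  "transpose_mat (bidiag \<alpha> \<beta> k) * eye (k + 1) k = bidiag_upper \<alpha> \<beta> k"
proof (rule eq_matI)
  fix i j assume "i < dim_row (bidiag_upper \<alpha> \<beta> k)" "j < dim_col (bidiag_upper \<alpha> \<beta> k)"
  then show "(transpose_mat (bidiag \<alpha> \<beta> k) * eye (k + 1) k) $$ (i, j) = bidiag_upper \<alpha> \<beta> k $$ (i, j)"
    using mult_eye_index[of "transpose_mat (bidiag \<alpha> \<beta> k)" k "k + 1" i j k]
    by (simp add: bidiag_upper_def bidiag_def del: index_mult_mat(1))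
qed (auto simp: bidiag_upper_def bidiag_def eye_def)

section \<open>The joint bidiagonalization process\<close>

lemma cols_upto_carrier [simp]: "cols_upto d w j \<in> carrier_mat d j"
  by (auto simp: cols_upto_def simp del: upt_Suc intro!: carrier_matI)

lemma col_cols_upto: "l < j \<Longrightarrow> w (l + 1) \<in> carrier_vec d \<Longrightarrow> col (cols_upto d w j) l = w (l + 1)"
  by (simp add: cols_upto_def del: upt_Suc)

lemma mult_cols_upto:
  assumes "A \<in> carrier_mat d' d" "\<And>l. l < j \<Longrightarrow> w (l + 1) \<in> carrier_vec d"
  shows "A * cols_upto d w j = cols_upto d' (\<lambda>i. A *\<^sub>v w i) j"
proof (rule mat_col_eqI)
  fix l assume "l < dim_col (cols_upto d' (\<lambda>i. A *\<^sub>v w i) j)"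
  then have l: "l < j" by (simp add: cols_upto_def del: upt_Suc)
  have "col (A * cols_upto d w j) l = A *\<^sub>v col (cols_upto d w j) l"
    using assms(1) l by (intro col_mult2) auto
  then show "col (A * cols_upto d w j) l = col (cols_upto d' (\<lambda>i. A *\<^sub>v w i) j) l"
    using assms l mult_mat_vec_carrier[OF assms(1) assms(2)[OF l]] by (simp add: col_cols_upto)
qed (use assms in \<open>auto simp: cols_upto_def simp del: upt_Suc\<close>)

text \<open>The two recurrences in a form without block matrices. The second one is cut down to its first
  \<open>k\<close> columns: the term with \<open>\<alpha> (k + 1)\<close> lives in the last column only, and the remaining
  \<open>k\<close> columns of the transposed lower bidiagonal matrix form the square upper bidiagonal one.\<close>

lemma jbd_error_relations:
  assumes jbd: "jbd_finite_precision m p k Q \<epsilon> c\<^sub>1 c\<^sub>F c\<^sub>G c\<^sub>U c\<^sub>\<beta> \<alpha> \<beta> u vt"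
    and Q: "Q \<in> carrier_mat (m + p) n"
  obtains F G where "F \<in> carrier_mat m k" "G \<in> carrier_mat (m + p) k"
    "eye m (m + p) * cols_upto (m + p) vt k = cols_upto m u (k + 1) * bidiag \<alpha> \<beta> k + F"
    "Q * transpose_mat Q * (eye (m + p) m * (cols_upto m u (k + 1) * eye (k + 1) k))
      = cols_upto (m + p) vt k * bidiag_upper \<alpha> \<beta> k + G"
    "\<forall>x \<in> carrier_vec k. norm2_vec (F *\<^sub>v x) \<le> c\<^sub>F * \<epsilon> * norm2_vec x"
    "\<forall>x \<in> carrier_vec k. norm2_vec (G *\<^sub>v x) \<le> c\<^sub>G * \<epsilon> * norm2_vec x"
proof -
  define U where "U = cols_upto m u (k + 1)"
  define Vt where "Vt = cols_upto (m + p) vt k"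
  define W where "W = \<alpha> (k + 1) \<cdot>\<^sub>m
    (mat_of_cols (m + p) [vt (k + 1)] * mat_of_rows (k + 1) [unit_vec (k + 1) k])"
  define P where "P = Q * transpose_mat Q"
  define BT where "BT = transpose_mat (bidiag \<alpha> \<beta> k)"
  define H where "H = eye (k + 1) k"
  obtain F where F: "F \<in> carrier_mat m k" "eye m (m + p) * Vt = U * bidiag \<alpha> \<beta> k + F" "norm2_mat F \<le> c\<^sub>F * \<epsilon>"
    using jbd unfolding jbd_finite_precision_def four_block_eq_eye U_def Vt_def by blast
  obtain G where G: "G \<in> carrier_mat (m + p) (k + 1)" "P * (U @\<^sub>r 0\<^sub>m p (k + 1)) = Vt * BT + W + G"
      "norm2_mat G \<le> c\<^sub>G * \<epsilon>"
    using jbd unfolding jbd_finite_precision_def U_def Vt_def W_def P_def BT_def by blast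
  have c: "U \<in> carrier_mat m (k + 1)" "Vt \<in> carrier_mat (m + p) k" "W \<in> carrier_mat (m + p) (k + 1)"
      "P \<in> carrier_mat (m + p) (m + p)" "BT \<in> carrier_mat k (k + 1)" "H \<in> carrier_mat (k + 1) k"
    using Q by (auto simp: U_def Vt_def W_def P_def BT_def H_def bidiag_def)
  have WH: "W * H = 0\<^sub>m (m + p) k"
  proof (rule eq_matI)
    fix i j assume ij: "i < dim_row (0\<^sub>m (m + p) k)" "j < dim_col (0\<^sub>m (m + p) k)"
    then have "(W * H) $$ (i, j) = W $$ (i, j)"
      using mult_eye_index[OF c(3), of i j k] by (simp add: H_def del: index_mult_mat(1))
    also have "\<dots> = 0"
      using ij by (simp add: W_def scalar_prod_def mat_of_rows_def unit_vec_def)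
    finally show "(W * H) $$ (i, j) = 0\<^sub>m (m + p) k $$ (i, j)" using ij by simp
  qed (use c in auto)
  have "P * (eye (m + p) m * (U * H)) = P * (eye (m + p) m * U) * H"
    using assoc_mult_mat[OF eye_carrier[of "m + p" m] c(1) c(6)]
      assoc_mult_mat[OF c(4) mult_carrier_mat[OF eye_carrier[of "m + p" m] c(1)] c(6)] by simp
  also have "\<dots> = (Vt * BT + W + G) * H"
    using G(2) append_zero_rows_eq_eye_mult[OF c(1), of p] by simp
  also have "\<dots> = Vt * BT * H + W * H + G * H"
    using c G(1) by (simp add: add_mult_distrib_mat[of _ "m + p" "k + 1" _ H k])
  also have "\<dots> = Vt * bidiag_upper \<alpha> \<beta> k + G * H"
    using c G(1) WH transpose_bidiag_mult_eye[of \<alpha> \<beta> k] assoc_mult_mat[OF c(2) c(5) c(6)]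
      right_add_zero_mat[OF mult_carrier_mat[OF c(2), of "bidiag_upper \<alpha> \<beta> k" k]]
    by (simp add: BT_def H_def bidiag_upper_def)
  finally have eq: "P * (eye (m + p) m * (U * H)) = Vt * bidiag_upper \<alpha> \<beta> k + G * H" .
  have "norm2_vec (G * H *\<^sub>v x) \<le> c\<^sub>G * \<epsilon> * norm2_vec x" if x: "x \<in> carrier_vec k" for x
  proof -
    have "H *\<^sub>v x \<in> carrier_vec (k + 1)" using c(6) x by simp
    moreover have "norm2_vec (H *\<^sub>v x) = norm2_vec x"
      unfolding H_def by (rule orthonormal_cols_norm[OF eye_carrier eye_orthonormal_cols x]) simp
    ultimately show ?thesis
      using norm2_mat_mult_bound[OF G(1,3), of "H *\<^sub>v x"] assoc_mult_mat_vec[OF G(1) c(6) x] by simp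
  qed
  moreover have "norm2_vec (F *\<^sub>v x) \<le> c\<^sub>F * \<epsilon> * norm2_vec x" if x: "x \<in> carrier_vec k" for x
    using norm2_mat_mult_bound[OF F(1,3) x] .
  ultimately show thesis
    using that[of F "G * H"] F(1,2) eq mult_carrier_mat[OF G(1) c(6)]
    unfolding U_def Vt_def P_def H_def by blast
qed

text \<open>The error bound with explicit constants. Here \<open>\<mu>\<close> is the level of semiorthogonality, and \<open>t\<close>
  collects the two reasons for which the diagonals of \<open>R\<^sub>U\<close> and \<open>S\<close> differ from 1: the loss of
  orthogonality and, for \<open>S\<close>, the loss of length when \<open>vt i\<close> is projected to \<open>v i\<close>.\<close>

lemma projected_matrix_error:
  fixes k :: nat and U V M N R\<^sub>U S Q\<^sub>A Q\<^sub>L Q Binv :: "real mat"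
  assumes k: "1 \<le> k"
    and QA: "Q\<^sub>A \<in> carrier_mat m n" and QL: "Q\<^sub>L \<in> carrier_mat p n" and Qeq: "Q = Q\<^sub>A @\<^sub>r Q\<^sub>L"
    and QQ: "transpose_mat Q * Q = 1\<^sub>m n"
    and jbd: "jbd_finite_precision m p k Q \<epsilon> c\<^sub>1 c\<^sub>F c\<^sub>G c\<^sub>U c\<^sub>\<beta> \<alpha> \<beta> u vt"
    and Binv: "Binv \<in> carrier_mat k k" "bidiag_upper \<alpha> \<beta> k * Binv = 1\<^sub>m k"
      "Binv * bidiag_upper \<alpha> \<beta> k = 1\<^sub>m k"
    and eps: "0 < \<epsilon>" "0 \<le> c\<^sub>G" "c\<^sub>F * \<epsilon> \<le> 1" "0 \<le> c\<^sub>F"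
    and U: "U = cols_upto m u (k + 1)" and V: "V = cols_upto n (\<lambda>i. transpose_mat Q *\<^sub>v vt i) k"
    and qrU: "compact_qr U M R\<^sub>U" "pos_diag R\<^sub>U" and qrV: "compact_qr V N S" "pos_diag S"
    and \<mu>: "0 \<le> \<mu>" "\<mu> \<le> 1 / 2" "xi U \<le> \<mu>" "xi V \<le> \<mu>"
    and t_def: "t = (c\<^sub>G * \<epsilon> * norm2_mat Binv)\<^sup>2 + \<mu>\<^sup>2 * 9 ^ (k + 1)" and t: "t \<le> 1 / 2"
  shows "1 \<le> 4 * norm2_mat Binv"
    and "i < k + 1 \<Longrightarrow> j < k \<Longrightarrow>
      \<bar>(transpose_mat M * Q\<^sub>A * N) $$ (i, j) - bidiag \<alpha> \<beta> k $$ (i, j)\<bar>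
        \<le> 2 * ((c\<^sub>F * \<epsilon> + c\<^sub>G * \<epsilon> + c\<^sub>G * \<epsilon> * norm2_mat Binv) * 3 ^ k + 4 * t)"
proof -
  define g where "g = c\<^sub>G * \<epsilon>"
  define f where "f = c\<^sub>F * \<epsilon>"
  define \<nu> where "\<nu> = norm2_mat Binv"
  define Vt where "Vt = cols_upto (m + p) vt k"
  define J where "J = eye m (m + p)"
  define H where "H = eye (k + 1) k"
  define B where "B = bidiag \<alpha> \<beta> k"
  define T where "T = bidiag_upper \<alpha> \<beta> k"
  \<comment> \<open>\<open>J\<close> is the block row \<open>(I, 0)\<close> and \<open>H\<close> drops the last column. Multiplying the second
    recurrence by \<open>H\<close> removes its \<open>\<alpha> (k + 1)\<close> term and turns the transpose of \<open>B\<close> into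
    \<open>T\<close>.\<close>
  have Q: "Q \<in> carrier_mat (m + p) n" unfolding Qeq using QA QL by (rule carrier_append_rows)
  have Qt: "transpose_mat Q \<in> carrier_mat n (m + p)" using Q by simp
  have g0: "0 \<le> g" using eps by (simp add: g_def)
  have f0: "0 \<le> f" using eps by (simp add: f_def)
  have u: "u (l + 1) \<in> carrier_vec m" "norm2_vec (u (l + 1)) = 1" if "l < k + 1" for l
    using jbd that unfolding jbd_finite_precision_def by auto
  have vt: "vt (l + 1) \<in> carrier_vec (m + p)" "norm2_vec (vt (l + 1)) = 1" if "l < k" for l
    using jbd that unfolding jbd_finite_precision_def by auto
  have colU: "norm2_vec (col U l) = 1" if "l < k + 1" for l
    using u[OF that] that by (simp add: U col_cols_upto)
  have colVt: "norm2_vec (col Vt l) = 1" if "l < k" for l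
    using vt[OF that] that by (simp add: Vt_def col_cols_upto)
  have Jtr: "transpose_mat J = eye (m + p) m" by (simp add: J_def transpose_eye)
  have JJ: "transpose_mat (transpose_mat J) * transpose_mat J = 1\<^sub>m m"
    unfolding Jtr by (rule eye_orthonormal_cols) simp
  have c: "U \<in> carrier_mat m (k + 1)" "V \<in> carrier_mat n k" "Vt \<in> carrier_mat (m + p) k"
      "J \<in> carrier_mat m (m + p)" "transpose_mat J \<in> carrier_mat (m + p) m"
      "H \<in> carrier_mat (k + 1) k" "B \<in> carrier_mat (k + 1) k" "T \<in> carrier_mat k k"
    by (auto simp: U V Vt_def J_def H_def B_def T_def transpose_eye bidiag_def bidiag_upper_def)
  have dims: "dim_row U = m" "dim_col U = k + 1" "dim_row V = n" "dim_col V = k" using c(1,2) by auto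
  note cM = compact_qrD[OF qrU(1), unfolded dims] and cN = compact_qrD[OF qrV(1), unfolded dims]
  have Veq: "V = transpose_mat Q * Vt"
    unfolding V Vt_def using vt(1) by (intro mult_cols_upto[symmetric] Qt) auto
  have QAeq: "Q\<^sub>A = J * Q"
    unfolding J_def Qeq using eye_mult_append_rows[OF QA QL] by simp
  have Jcontr: "norm2_vec (J *\<^sub>v x) \<le> norm2_vec x" if "x \<in> carrier_vec (m + p)" for x
    using orthonormal_cols_transpose_norm_le[OF c(5) JJ that] by simp
  obtain F G where FG: "F \<in> carrier_mat m k" "G \<in> carrier_mat (m + p) k"
      "J * Vt = U * B + F"
      "Q * transpose_mat Q * (transpose_mat J * (U * H)) = Vt * T + G"
      "\<forall>x \<in> carrier_vec k. norm2_vec (F *\<^sub>v x) \<le> f * norm2_vec x"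
      "\<forall>x \<in> carrier_vec k. norm2_vec (G *\<^sub>v x) \<le> g * norm2_vec x"
  proof (rule jbd_error_relations[OF jbd Q], goal_cases)
    case (1 F G)
    then show ?case
      by (intro that[of F G]; unfold U Vt_def Jtr H_def B_def T_def f_def g_def; unfold J_def)
  qed
  \<comment> \<open>\<open>D\<close> is the component of \<open>Vt\<close> outside the range of \<open>Q\<close>. It is the only quantity
    that costs a factor \<open>\<nu>\<close>.\<close>
  define D where "D = Vt - Q * V"
  have cD: "D \<in> carrier_mat (m + p) k" "Q * V \<in> carrier_mat (m + p) k" using Q c by (auto simp: D_def)
  have colD: "col D l = col Vt l - Q *\<^sub>v (transpose_mat Q *\<^sub>v col Vt l)" if "l < k" for l
  proof -
    have "col D l = col Vt l - col (Q * V) l"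
      unfolding D_def by (rule col_diff[OF c(3) cD(2) that])
    also have "col (Q * V) l = Q *\<^sub>v (transpose_mat Q *\<^sub>v col Vt l)"
      using col_mult2[OF Q c(2) that] col_mult2[OF Qt c(3) that] by (simp add: Veq)
    finally show ?thesis .
  qed
  have cUH: "transpose_mat J * (U * H) \<in> carrier_mat (m + p) k"
    by (rule mult_carrier_mat[OF c(5) mult_carrier_mat[OF c(1,6)]])
  have normD: "norm2_vec (col D l) \<le> g * \<nu>" if "l < k" for l
    unfolding colD[OF that] \<nu>_def
    by (rule near_range_of_perturbed_projection[OF Q QQ c(3) cUH FG(2) c(8) Binv(1)
          Binv(2)[folded T_def] FG(4) FG(6)[rule_format] g0 that])

  \<comment> \<open>The part of a column of \<open>Vt\<close> that \<open>V\<close> loses is orthogonal to the range of \<open>Q\<close>,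
    so by Pythagoras the loss in the squared length is quadratic.\<close>
  have colV: "1 - (g * \<nu>)\<^sup>2 \<le> (norm2_vec (col V l))\<^sup>2 \<and> (norm2_vec (col V l))\<^sup>2 \<le> 1" if "l < k" for l
  proof -
    have e: "col V l = transpose_mat Q *\<^sub>v col Vt l"
      unfolding Veq using col_mult2[OF Qt c(3) that] by simp
    have "(norm2_vec (col D l))\<^sup>2 = 1 - (norm2_vec (col V l))\<^sup>2"
      using orthonormal_cols_complement[OF Q QQ, of "col Vt l"] c(3) that colVt[OF that]
      by (simp add: colD e)
    moreover have "(norm2_vec (col D l))\<^sup>2 \<le> (g * \<nu>)\<^sup>2"
      using normD[OF that] norm2_vec_nonneg by (intro power_mono)
    moreover have "0 \<le> (norm2_vec (col D l))\<^sup>2" by simp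
    ultimately show ?thesis by linarith
  qed
  have td: "t = (g * \<nu>)\<^sup>2 + \<mu>\<^sup>2 * 9 ^ (k + 1)" by (simp add: t_def g_def \<nu>_def)
  \<comment> \<open>The factors have different sizes: the bound for \<open>R\<^sub>U\<close> has \<open>9 ^ (k + 1)\<close>, the one for
    \<open>S\<close> has \<open>9 ^ k\<close>, and \<open>t\<close> serves both.\<close>
  have tk: "(g * \<nu>)\<^sup>2 + \<mu>\<^sup>2 * 9 ^ k \<le> t"
    unfolding td by (intro add_left_mono mult_left_mono power_increasing) auto
  have dU: "1 - (g * \<nu>)\<^sup>2 \<le> (norm2_vec (col U l))\<^sup>2 \<and> (norm2_vec (col U l))\<^sup>2 \<le> 1"
    if "l < dim_col U" for l using colU that dims(2) by simp
  have RU: "\<bar>R\<^sub>U $$ (l, j)\<bar> \<le> 1" if "l \<le> j" "j < k + 1" for l j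
    by (rule compact_qr_factor_near_identity(1)[OF qrU dU \<mu>(3,1)]) (use t that dims(2) td in auto)
  have RU': "1 - t \<le> R\<^sub>U $$ (j, j)" if "j < k + 1" for j
    using compact_qr_factor_near_identity(2)[OF qrU dU \<mu>(3,1)] t that unfolding dims(2) td by simp
  have dV: "1 - (g * \<nu>)\<^sup>2 \<le> (norm2_vec (col V l))\<^sup>2 \<and> (norm2_vec (col V l))\<^sup>2 \<le> 1"
    if "l < dim_col V" for l using colV that dims(4) by simp
  have smallV: "(g * \<nu>)\<^sup>2 + \<mu>\<^sup>2 * 9 ^ dim_col V \<le> 1 / 2" using tk t dims(4) by simp
  have SU: "\<bar>S $$ (l, j)\<bar> \<le> 1" if "l \<le> j" "j < k" for l j
    by (rule compact_qr_factor_near_identity(1)[OF qrV dV \<mu>(4,1) smallV]) (use that dims(4) in auto)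
  have SU': "1 - t \<le> S $$ (j, j)" if "j < k" for j
    using compact_qr_factor_near_identity(2)[OF qrV dV \<mu>(4,1) smallV, of j] tk that dims(4) by simp

  have colF: "norm2_vec (col F l) \<le> f" if "l < k" for l
    by (rule norm2_vec_col_le[OF FG(1) FG(5)[rule_format] that])
  have colG: "norm2_vec (col G l) \<le> g" if "l < k" for l
    by (rule norm2_vec_col_le[OF FG(2) FG(6)[rule_format] that])
  have colJ: "col (J * A) l = J *\<^sub>v col A l" if "A \<in> carrier_mat (m + p) k" "l < k" for A l
    by (rule col_mult2[OF c(4) that])
  have cUB: "U * B \<in> carrier_mat m k" by (rule mult_carrier_mat[OF c(1,7)])
  define Y where "Y = J * Vt - F"
  have cY: "Y \<in> carrier_mat m k" using c FG(1) by (auto simp: Y_def)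
  have UB: "U * B = Y"
    unfolding Y_def FG(3) using cUB FG(1) by (intro eq_matI) (auto simp del: index_mult_mat)
  have nY: "norm2_vec (col Y l) \<le> 2" if "l < k" for l
  proof -
    have Jc: "J *\<^sub>v col Vt l \<in> carrier_vec m" "col Vt l \<in> carrier_vec (m + p)"
      using mult_mat_vec_carrier[OF c(4) col_carrier_vec[OF that c(3)]] col_carrier_vec[OF that c(3)] by auto
    have "col Y l = col (J * Vt) l - col F l"
      unfolding Y_def by (rule col_diff[OF mult_carrier_mat[OF c(4,3)] FG(1) that])
    also have "\<dots> = J *\<^sub>v col Vt l - col F l" using colJ[OF c(3) that] by simp
    finally have "norm2_vec (col Y l) \<le> norm2_vec (J *\<^sub>v col Vt l) + norm2_vec (col F l)"
      using norm2_vec_diff_le[OF Jc(1), of "col F l"] FG(1) that by simp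
    then show ?thesis using Jcontr[OF Jc(2)] colVt[OF that] colF[OF that] eps(3) by (simp add: f_def)
  qed
  have xiU: "xi U \<le> 1 / 2" using \<mu> by linarith
  have ab: "\<bar>\<alpha> i\<bar> \<le> 4 \<and> \<bar>\<beta> (i + 1)\<bar> \<le> 4" if "1 \<le> i" "i \<le> k" for i
    using bidiag_coefficients_le[OF c(1) colU xiU cY UB[unfolded B_def] nY that] by blast
  have \<nu>0: "0 \<le> \<nu>" by (simp add: \<nu>_def norm2_mat_nonneg)
  have "1 \<le> \<nu> * \<bar>\<alpha> 1\<bar>"
    using norm2_mat_inverse_bidiag_upper_ge[OF Binv(1,3) k] by (simp add: \<nu>_def)
  also have "\<dots> \<le> \<nu> * 4" using ab[of 1] k \<nu>0 by (intro mult_left_mono) auto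
  finally show "1 \<le> 4 * norm2_mat Binv" by (simp add: \<nu>_def)

  define X where "X = transpose_mat M * Q\<^sub>A * N"
  define b where "b = f + g + g * \<nu>"
  have cX: "X \<in> carrier_mat (k + 1) k" using cM(1) cN(1) QA by (auto simp: X_def)
  have Mt: "transpose_mat M \<in> carrier_mat (k + 1) m" and Nt: "transpose_mat N \<in> carrier_mat k n"
    and QAt: "transpose_mat Q\<^sub>A \<in> carrier_mat n m"
    using cM(1) cN(1) QA by auto
  \<comment> \<open>First relation: \<open>Q\<^sub>A V\<close> differs from \<open>U B\<close> by \<open>F'\<close>, and applying \<open>M\<^sup>T\<close>
    gives \<open>X S = R\<^sub>U B + M\<^sup>T F'\<close>.\<close>
  define F' where "F' = F - J * D"
  have cJD: "J * D \<in> carrier_mat m k" by (rule mult_carrier_mat[OF c(4) cD(1)])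
  have cF': "F' \<in> carrier_mat m k" unfolding F'_def by (rule minus_carrier_mat[OF cJD])
  have nF': "norm2_vec (col F' l) \<le> f + g * \<nu>" if "l < k" for l
  proof -
    have Jc: "J *\<^sub>v col D l \<in> carrier_vec m" "col D l \<in> carrier_vec (m + p)"
      using mult_mat_vec_carrier[OF c(4) col_carrier_vec[OF that cD(1)]] col_carrier_vec[OF that cD(1)] by auto
    have "col F' l = col F l - col (J * D) l"
      unfolding F'_def by (rule col_diff[OF FG(1) cJD that])
    also have "\<dots> = col F l - J *\<^sub>v col D l" using colJ[OF cD(1) that] by simp
    finally have "norm2_vec (col F' l) \<le> norm2_vec (col F l) + norm2_vec (J *\<^sub>v col D l)"
      using norm2_vec_diff_le[OF _ Jc(1), of "col F l"] FG(1) that by simp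
    then show ?thesis using Jcontr[OF Jc(2)] normD[OF that] colF[OF that] by simp
  qed
  have QAV: "Q\<^sub>A * V = U * B + F'"
  proof -
    have "Q\<^sub>A * V = J * (Q * V)" unfolding QAeq by (rule assoc_mult_mat[OF c(4) Q c(2)])
    also have "Q * V = Vt - D" unfolding D_def using cD(2) c(3) by (intro eq_matI) (auto simp del: index_mult_mat)
    also have "J * (Vt - D) = J * Vt - J * D" by (rule mult_minus_distrib_mat[OF c(4) c(3) cD(1)])
    also have "\<dots> = U * B + F'"
      unfolding FG(3) F'_def using cUB FG(1) cJD by (intro eq_matI) (auto simp del: index_mult_mat)
    finally show ?thesis .
  qed
  have XS: "\<bar>(X * S) $$ (i, j) - (R\<^sub>U * B) $$ (i, j)\<bar> \<le> b" if "i < k + 1" "j < k" for i j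
  proof -
    have "X * S = transpose_mat M * Q\<^sub>A * V"
      unfolding X_def cN(5) by (rule assoc_mult_mat[OF mult_carrier_mat[OF Mt QA] cN(1,2)])
    also have "\<dots> = transpose_mat M * (U * B + F')"
      unfolding QAV[symmetric] by (rule assoc_mult_mat[OF Mt QA c(2)])
    also have "\<dots> = transpose_mat M * (U * B) + transpose_mat M * F'"
      by (rule mult_add_distrib_mat[OF Mt cUB cF'])
    also have "transpose_mat M * (U * B) = transpose_mat M * U * B"
      by (rule assoc_mult_mat[OF Mt c(1,7), symmetric])
    also have "transpose_mat M * U = transpose_mat M * M * R\<^sub>U"
      unfolding cM(5) by (rule assoc_mult_mat[OF Mt cM(1,2), symmetric])
    also have "\<dots> = R\<^sub>U" using cM(2,3) by simp
    finally have "(X * S) $$ (i, j) - (R\<^sub>U * B) $$ (i, j) = (transpose_mat M * F') $$ (i, j)"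
      using that c(7) cM(2) Mt cF' by (simp del: index_mult_mat(1) add: index_mult_mat(2,3))
    moreover have "\<bar>(transpose_mat M * F') $$ (i, j)\<bar> \<le> f + g * \<nu>"
      by (rule transpose_mult_index_le[OF cM(1) cF' that
            norm2_vec_col_orthonormal[OF cM(1,3) that(1)] nF'[OF that(2)]])
    ultimately show ?thesis using g0 by (simp add: b_def)
  qed
  \<comment> \<open>Second relation: \<open>Q\<^sup>T Q = 1\<close> cancels the projector of the second recurrence, and applying
    \<open>N\<^sup>T\<close> gives that the first \<open>k\<close> columns of \<open>X\<^sup>T R\<^sub>U\<close> are
    \<open>S T + N\<^sup>T Q\<^sup>T G\<close>.\<close>
  have XR: "\<bar>(transpose_mat X * R\<^sub>U) $$ (j, i) - (S * T) $$ (j, i)\<bar> \<le> b" if "i < k" "j < k" for i j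
  proof -
    have cQU: "transpose_mat Q\<^sub>A * U \<in> carrier_mat n (k + 1)" by (rule mult_carrier_mat[OF QAt c(1)])
    have cJU: "transpose_mat J * (U * H) \<in> carrier_mat (m + p) k" by (fact cUH)
    have cVT: "Vt * T \<in> carrier_mat (m + p) k" by (rule mult_carrier_mat[OF c(3,8)])
    have cST: "S * T \<in> carrier_mat k k" by (rule mult_carrier_mat[OF cN(2) c(8)])
    have cQG: "transpose_mat Q * G \<in> carrier_mat n k" by (rule mult_carrier_mat[OF Qt FG(2)])
    have cNG: "transpose_mat N * (transpose_mat Q * G) \<in> carrier_mat k k"
      by (rule mult_carrier_mat[OF Nt cQG])
    have "transpose_mat X = transpose_mat N * (transpose_mat Q\<^sub>A * M)"
      unfolding X_def
      using transpose_mult[OF mult_carrier_mat[OF Mt QA] cN(1)] transpose_mult[OF Mt QA] by simp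
    then have "transpose_mat X * R\<^sub>U = transpose_mat N * (transpose_mat Q\<^sub>A * U)"
      using assoc_mult_mat[OF Nt mult_carrier_mat[OF QAt cM(1)] cM(2)] assoc_mult_mat[OF QAt cM(1,2)]
      by (simp add: cM(5))
    then have "(transpose_mat X * R\<^sub>U) $$ (j, i) = (transpose_mat N * (transpose_mat Q\<^sub>A * U) * H) $$ (j, i)"
      using mult_eye_index[OF mult_carrier_mat[OF Nt cQU] that(2,1)] that
      by (simp add: H_def del: index_mult_mat(1))
    also have "transpose_mat N * (transpose_mat Q\<^sub>A * U) * H = transpose_mat N * (transpose_mat Q\<^sub>A * (U * H))"
      using assoc_mult_mat[OF Nt cQU c(6)] assoc_mult_mat[OF QAt c(1,6)] by simp
    also have "transpose_mat Q\<^sub>A * (U * H) = transpose_mat Q * (transpose_mat J * (U * H))"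
      unfolding QAeq transpose_mult[OF c(4) Q]
      by (rule assoc_mult_mat[OF Qt c(5) mult_carrier_mat[OF c(1,6)]])
    also have "\<dots> = transpose_mat Q * (Q * transpose_mat Q * (transpose_mat J * (U * H)))"
      using assoc_mult_mat[OF Q Qt cJU]
        assoc_mult_mat[OF Qt Q mult_carrier_mat[OF Qt cJU]] QQ mult_carrier_mat[OF Qt cJU]
      by (metis left_mult_one_mat)
    also have "\<dots> = transpose_mat Q * (Vt * T) + transpose_mat Q * G"
      unfolding FG(4) by (rule mult_add_distrib_mat[OF Qt cVT FG(2)])
    also have "transpose_mat Q * (Vt * T) = N * (S * T)"
      using assoc_mult_mat[OF Qt c(3,8)] assoc_mult_mat[OF cN(1,2) c(8)] by (metis Veq cN(5))
    also have "transpose_mat N * (N * (S * T) + transpose_mat Q * G)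
        = transpose_mat N * (N * (S * T)) + transpose_mat N * (transpose_mat Q * G)"
      by (rule mult_add_distrib_mat[OF Nt mult_carrier_mat[OF cN(1) cST] cQG])
    also have "transpose_mat N * (N * (S * T)) = S * T"
      using assoc_mult_mat[OF Nt cN(1) cST] cN(3) cST by (metis left_mult_one_mat)
    finally have "(transpose_mat X * R\<^sub>U) $$ (j, i) - (S * T) $$ (j, i)
        = (transpose_mat N * (transpose_mat Q * G)) $$ (j, i)"
      using that cNG cST by (simp del: index_mult_mat)
    moreover have "norm2_vec (col (transpose_mat Q * G) i) \<le> g"
      using orthonormal_cols_transpose_norm_le[OF Q QQ, of "col G i"] colG[OF that(1)]
        col_mult2[OF Qt FG(2) that(1)] FG(2) that by simp
    then have "\<bar>(transpose_mat N * (transpose_mat Q * G)) $$ (j, i)\<bar> \<le> g"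
      by (rule transpose_mult_index_le[OF cN(1) cQG that(2,1)
            norm2_vec_col_orthonormal[OF cN(1,3) that(2)]])
    ultimately show ?thesis using f0 mult_nonneg_nonneg[OF g0 \<nu>0] by (simp add: b_def)
  qed
  show "\<bar>(transpose_mat M * Q\<^sub>A * N) $$ (i, j) - bidiag \<alpha> \<beta> k $$ (i, j)\<bar>
        \<le> 2 * ((c\<^sub>F * \<epsilon> + c\<^sub>G * \<epsilon> + c\<^sub>G * \<epsilon> * norm2_mat Binv) * 3 ^ k + 4 * t)"
    if "i < k + 1" "j < k"
    using bidiagonal_from_triangular_relations[OF cX cN(2,4) cM(2,4) SU SU' RU RU' t
        XS[unfolded B_def] XR[unfolded T_def] ab that]
    unfolding X_def b_def f_def g_def \<nu>_def by blast
qed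

theorem theorem4p1:
  fixes k :: nat and c\<^sub>1 c\<^sub>F c\<^sub>G c\<^sub>U c\<^sub>\<beta> \<kappa> :: real
  assumes "1 \<le> k"
    and "0 \<le> c\<^sub>1" "0 \<le> c\<^sub>F" "0 \<le> c\<^sub>G" "0 \<le> c\<^sub>U" "0 \<le> c\<^sub>\<beta>" "0 < \<kappa>"
  shows "\<exists>K > 0. \<exists>\<tau> > 0.
    \<forall>(m :: nat) (n :: nat) (p :: nat) (A :: real mat) (L :: real mat)
      (Q\<^sub>A :: real mat) (Q\<^sub>L :: real mat) (Q :: real mat) (R :: real mat)
      (\<epsilon> :: real) (\<alpha> :: nat \<Rightarrow> real) (\<beta> :: nat \<Rightarrow> real)
      (u :: nat \<Rightarrow> real vec) (vt :: nat \<Rightarrow> real vec) (v :: nat \<Rightarrow> real vec)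
      (U :: real mat) (V :: real mat) (Binv :: real mat)
      (M :: real mat) (R\<^sub>U :: real mat) (N :: real mat) (S :: real mat) (\<delta> :: real).
      A \<in> carrier_mat m n \<longrightarrow> L \<in> carrier_mat p n \<longrightarrow>
      vec_space.rank (m + p) (A @\<^sub>r L) = n \<longrightarrow>
      Q\<^sub>A \<in> carrier_mat m n \<longrightarrow> Q\<^sub>L \<in> carrier_mat p n \<longrightarrow> Q = Q\<^sub>A @\<^sub>r Q\<^sub>L \<longrightarrow>
      compact_qr (A @\<^sub>r L) Q R \<longrightarrow> invertible_mat R \<longrightarrow>
      jbd_finite_precision m p k Q \<epsilon> c\<^sub>1 c\<^sub>F c\<^sub>G c\<^sub>U c\<^sub>\<beta> \<alpha> \<beta> u vt \<longrightarrow>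
      Binv \<in> carrier_mat k k \<longrightarrow>
      inverts_mat (bidiag_upper \<alpha> \<beta> k) Binv \<longrightarrow> inverts_mat Binv (bidiag_upper \<alpha> \<beta> k) \<longrightarrow>
      0 < \<epsilon> \<longrightarrow> \<epsilon> \<le> \<tau> \<longrightarrow> norm2_mat Binv * \<epsilon> \<le> \<tau> \<longrightarrow>
      (\<forall>i. v i = transpose_mat Q *\<^sub>v vt i) \<longrightarrow>
      U = cols_upto m u (k + 1) \<longrightarrow> V = cols_upto n v k \<longrightarrow>
      compact_qr U M R\<^sub>U \<longrightarrow> pos_diag R\<^sub>U \<longrightarrow>
      compact_qr V N S \<longrightarrow> pos_diag S \<longrightarrow>
      \<delta> = \<kappa> * norm2_mat Binv * \<epsilon> \<longrightarrow>
      xi U \<le> sqrt (\<delta> / (2 * real k + 1)) \<longrightarrow> xi V \<le> sqrt (\<delta> / (2 * real k + 1)) \<longrightarrow>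
      (\<exists>E \<in> carrier_mat (k + 1) k.
        transpose_mat M * Q\<^sub>A * N = bidiag \<alpha> \<beta> k + E \<and>
        (\<forall>i < k + 1. \<forall>j < k. \<bar>E $$ (i, j)\<bar> \<le> K * \<delta> \<and>
           \<bar>E $$ (i, j)\<bar> \<le> K * (norm2_mat Binv * \<epsilon>)))"
proof -
  \<comment> \<open>With \<open>\<eta> = norm2_mat Binv * \<epsilon>\<close>, the recurrence errors are at most \<open>C\<^sub>b * \<eta>\<close> (using
    \<open>\<epsilon> \<le> 4 * \<eta>\<close>) and the diagonals of the triangular factors are within \<open>C\<^sub>t * \<eta>\<close> of 1.
    The summand \<open>K\<^sub>0 / \<kappa>\<close> of \<open>K\<close> converts multiples of \<open>\<eta>\<close> into multiples of
    \<open>\<delta> = \<kappa> * \<eta>\<close>. The threshold \<open>\<tau>\<close> makes each of \<open>c\<^sub>F * \<epsilon>\<close>, \<open>\<eta>\<close>, \<open>\<kappa> * \<eta>\<close>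
    and \<open>C\<^sub>t * \<eta>\<close> at most 1/4.\<close>
  define C\<^sub>b where "C\<^sub>b = 4 * c\<^sub>F + 5 * c\<^sub>G"
  define C\<^sub>t where "C\<^sub>t = c\<^sub>G\<^sup>2 + \<kappa> * 9 ^ (k + 1)"
  define K\<^sub>0 where "K\<^sub>0 = 2 * (C\<^sub>b * 3 ^ k + 4 * C\<^sub>t)"
  define K where "K = K\<^sub>0 / \<kappa> + K\<^sub>0"
  define \<tau> where "\<tau> = 1 / (4 * (1 + c\<^sub>F + \<kappa> + C\<^sub>t))"
  have Cb: "0 \<le> C\<^sub>b" using assms by (simp add: C\<^sub>b_def)
  have Ct: "0 < C\<^sub>t" using assms unfolding C\<^sub>t_def by (intro add_nonneg_pos) auto
  have K0: "0 < K\<^sub>0" using Cb Ct unfolding K\<^sub>0_def by (intro mult_pos_pos add_nonneg_pos) auto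
  have K: "0 < K" using K0 assms unfolding K_def by (intro add_pos_pos divide_pos_pos)
  have den: "0 < 1 + c\<^sub>F + \<kappa> + C\<^sub>t" using assms Ct by linarith
  have \<tau>: "0 < \<tau>" using den unfolding \<tau>_def by simp
  have small: "c * x \<le> 1 / 4" if "0 \<le> c" "c \<le> 1 + c\<^sub>F + \<kappa> + C\<^sub>t" "x \<le> \<tau>" for c x
  proof -
    have "c * x \<le> c * \<tau>" using that by (intro mult_left_mono) auto
    also have "\<dots> \<le> (1 + c\<^sub>F + \<kappa> + C\<^sub>t) * \<tau>" using that \<tau> by (intro mult_right_mono) auto
    also have "\<dots> = 1 / 4" using den by (simp add: \<tau>_def)
    finally show ?thesis .
  qed
  show ?thesis
  proof (rule exI[of _ K], rule conjI[OF K], rule exI[of _ \<tau>], rule conjI[OF \<tau>], intro allI impI)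
    fix m n p A L Q\<^sub>A Q\<^sub>L Q R \<epsilon> \<alpha> \<beta> u vt v U V Binv M R\<^sub>U N S \<delta>
    assume A: "A \<in> carrier_mat m n" and L: "L \<in> carrier_mat p n"
      and QA: "Q\<^sub>A \<in> carrier_mat m n" and QL: "Q\<^sub>L \<in> carrier_mat p n" and Q: "Q = Q\<^sub>A @\<^sub>r Q\<^sub>L"
      and qr: "compact_qr (A @\<^sub>r L) Q R"
      and jbd: "jbd_finite_precision m p k Q \<epsilon> c\<^sub>1 c\<^sub>F c\<^sub>G c\<^sub>U c\<^sub>\<beta> \<alpha> \<beta> u vt"
      and Binv: "Binv \<in> carrier_mat k k"
        "inverts_mat (bidiag_upper \<alpha> \<beta> k) Binv" "inverts_mat Binv (bidiag_upper \<alpha> \<beta> k)"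
      and eps: "0 < \<epsilon>" "\<epsilon> \<le> \<tau>" "norm2_mat Binv * \<epsilon> \<le> \<tau>"
      and v: "\<forall>i. v i = transpose_mat Q *\<^sub>v vt i"
      and U: "U = cols_upto m u (k + 1)" and V: "V = cols_upto n v k"
      and qrU: "compact_qr U M R\<^sub>U" "pos_diag R\<^sub>U" and qrV: "compact_qr V N S" "pos_diag S"
      and \<delta>: "\<delta> = \<kappa> * norm2_mat Binv * \<epsilon>"
      and xi: "xi U \<le> sqrt (\<delta> / (2 * real k + 1))" "xi V \<le> sqrt (\<delta> / (2 * real k + 1))"
    define \<eta> where "\<eta> = norm2_mat Binv * \<epsilon>"
    define \<mu> where "\<mu> = sqrt (\<delta> / (2 * real k + 1))"
    define t where "t = (c\<^sub>G * \<epsilon> * norm2_mat Binv)\<^sup>2 + \<mu>\<^sup>2 * 9 ^ (k + 1)"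
    have QQ: "transpose_mat Q * Q = 1\<^sub>m n"
      using compact_qrD(3)[OF qr] A L by (simp add: append_rows_def)
    have T: "bidiag_upper \<alpha> \<beta> k \<in> carrier_mat k k" by (simp add: bidiag_upper_def)
    have inv: "bidiag_upper \<alpha> \<beta> k * Binv = 1\<^sub>m k" "Binv * bidiag_upper \<alpha> \<beta> k = 1\<^sub>m k"
      using Binv T by (auto simp: inverts_mat_def)
    have nn: "0 \<le> norm2_mat Binv" by (rule norm2_mat_nonneg)
    have \<eta>: "0 \<le> \<eta>" "\<eta> \<le> \<tau>" using nn eps by (auto simp: \<eta>_def)
    have \<eta>1: "\<eta> \<le> 1" using small[of 1 \<eta>] \<eta> assms Ct by simp
    have \<delta>\<eta>: "\<delta> = \<kappa> * \<eta>" by (simp add: \<delta> \<eta>_def)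
    have \<delta>0: "0 \<le> \<delta>" using \<eta> assms by (simp add: \<delta>\<eta>)
    have \<mu>sq: "\<mu>\<^sup>2 \<le> \<delta>"
    proof -
      have "\<mu>\<^sup>2 = \<delta> / (2 * real k + 1)" using \<delta>0 by (simp add: \<mu>_def)
      also have "\<dots> \<le> \<delta> / 1" using \<delta>0 by (intro divide_left_mono) auto
      finally show ?thesis by simp
    qed
    have \<mu>0: "0 \<le> \<mu>" using \<delta>0 by (simp add: \<mu>_def)
    have "\<mu>\<^sup>2 \<le> (1 / 2)\<^sup>2"
      using \<mu>sq small[of \<kappa> \<eta>] \<eta> assms Ct by (simp add: \<delta>\<eta> power2_eq_square)
    then have \<mu>half: "\<mu> \<le> 1 / 2" by (rule power2_le_imp_le) simp
    have t: "t \<le> C\<^sub>t * \<eta>"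
    proof -
      have "\<eta>\<^sup>2 \<le> \<eta>" using \<eta> \<eta>1 by (simp add: power2_eq_square mult_left_le)
      then have "c\<^sub>G\<^sup>2 * \<eta>\<^sup>2 \<le> c\<^sub>G\<^sup>2 * \<eta>" by (intro mult_left_mono) auto
      moreover have "(c\<^sub>G * \<epsilon> * norm2_mat Binv)\<^sup>2 = c\<^sub>G\<^sup>2 * \<eta>\<^sup>2"
        by (simp add: \<eta>_def power_mult_distrib)
      moreover have "\<mu>\<^sup>2 * 9 ^ (k + 1) \<le> \<kappa> * \<eta> * 9 ^ (k + 1)"
        using \<mu>sq unfolding \<delta>\<eta> by (intro mult_right_mono) auto
      moreover have "C\<^sub>t * \<eta> = c\<^sub>G\<^sup>2 * \<eta> + \<kappa> * \<eta> * 9 ^ (k + 1)"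
        by (simp add: C\<^sub>t_def algebra_simps)
      ultimately show ?thesis unfolding t_def by linarith
    qed
    have thalf: "t \<le> 1 / 2" using t small[of C\<^sub>t \<eta>] \<eta> assms Ct by simp
    have cFe: "c\<^sub>F * \<epsilon> \<le> 1" using small[of c\<^sub>F \<epsilon>] eps assms Ct by simp
    have Veq: "V = cols_upto n (\<lambda>i. transpose_mat Q *\<^sub>v vt i) k"
    proof -
      have "v = (\<lambda>i. transpose_mat Q *\<^sub>v vt i)" using v by auto
      then show ?thesis using V by simp
    qed
    note res = projected_matrix_error[OF assms(1) QA QL Q QQ jbd Binv(1) inv eps(1) assms(4) cFe
        assms(3) U Veq qrU qrV \<mu>0 \<mu>half xi[folded \<mu>_def] t_def thalf]
    have "1 * \<epsilon> \<le> 4 * norm2_mat Binv * \<epsilon>" using res(1) eps by (intro mult_right_mono) auto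
    then have \<epsilon>\<eta>: "\<epsilon> \<le> 4 * \<eta>" by (simp add: \<eta>_def)
    have bound: "\<bar>(transpose_mat M * Q\<^sub>A * N) $$ (i, j) - bidiag \<alpha> \<beta> k $$ (i, j)\<bar> \<le> K\<^sub>0 * \<eta>"
      if "i < k + 1" "j < k" for i j
    proof -
      have "c\<^sub>F * \<epsilon> \<le> c\<^sub>F * (4 * \<eta>)" "c\<^sub>G * \<epsilon> \<le> c\<^sub>G * (4 * \<eta>)"
        using \<epsilon>\<eta> assms by (auto intro!: mult_left_mono)
      then have "c\<^sub>F * \<epsilon> + c\<^sub>G * \<epsilon> + c\<^sub>G * \<epsilon> * norm2_mat Binv \<le> C\<^sub>b * \<eta>"
        by (simp add: C\<^sub>b_def \<eta>_def algebra_simps)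
      then have "(c\<^sub>F * \<epsilon> + c\<^sub>G * \<epsilon> + c\<^sub>G * \<epsilon> * norm2_mat Binv) * 3 ^ k \<le> C\<^sub>b * \<eta> * 3 ^ k"
        by (intro mult_right_mono) auto
      then show ?thesis using res(2)[OF that] t by (simp add: K\<^sub>0_def algebra_simps)
    qed
    have K\<delta>: "K\<^sub>0 * \<eta> \<le> K * \<delta>" "K\<^sub>0 * \<eta> \<le> K * \<eta>"
    proof -
      have "K * \<delta> = K\<^sub>0 * \<eta> + K\<^sub>0 * \<delta>" using assms by (simp add: K_def \<delta>\<eta> field_simps)
      then show "K\<^sub>0 * \<eta> \<le> K * \<delta>" using K0 \<delta>0 by simp
      show "K\<^sub>0 * \<eta> \<le> K * \<eta>" using K0 \<eta> assms by (intro mult_right_mono) (auto simp: K_def)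
    qed
    define E where "E = transpose_mat M * Q\<^sub>A * N - bidiag \<alpha> \<beta> k"
    have B: "bidiag \<alpha> \<beta> k \<in> carrier_mat (k + 1) k" by (simp add: bidiag_def)
    have "dim_row U = m" "dim_col U = k + 1" "dim_row V = n" "dim_col V = k"
      unfolding U V using carrier_matD[OF cols_upto_carrier] by blast+
    moreover have "M \<in> carrier_mat (dim_row U) (dim_col U)" "N \<in> carrier_mat (dim_row V) (dim_col V)"
      by (rule compact_qrD(1)[OF qrU(1)]) (rule compact_qrD(1)[OF qrV(1)])
    ultimately have MN: "M \<in> carrier_mat m (k + 1)" "N \<in> carrier_mat n k"
      by (simp_all only:)
    have X: "transpose_mat M * Q\<^sub>A * N \<in> carrier_mat (k + 1) k"
      by (rule mult_carrier_mat[OF mult_carrier_mat[OF _ QA] MN(2)]) (use MN(1) in simp)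
    show "\<exists>E \<in> carrier_mat (k + 1) k.
        transpose_mat M * Q\<^sub>A * N = bidiag \<alpha> \<beta> k + E \<and>
        (\<forall>i < k + 1. \<forall>j < k. \<bar>E $$ (i, j)\<bar> \<le> K * \<delta> \<and>
           \<bar>E $$ (i, j)\<bar> \<le> K * (norm2_mat Binv * \<epsilon>))"
    proof (intro bexI[of _ E] conjI allI impI)
      show "E \<in> carrier_mat (k + 1) k" unfolding E_def by (rule minus_carrier_mat[OF B])
      show "transpose_mat M * Q\<^sub>A * N = bidiag \<alpha> \<beta> k + E"
        unfolding E_def using X B by (intro eq_matI) (auto simp del: index_mult_mat)
      fix i j assume ij: "i < k + 1" "j < k"
      have "\<bar>E $$ (i, j)\<bar> \<le> K\<^sub>0 * \<eta>"
        unfolding E_def using bound[OF ij] ij B by (simp del: index_mult_mat)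
      then show "\<bar>E $$ (i, j)\<bar> \<le> K * \<delta>" "\<bar>E $$ (i, j)\<bar> \<le> K * (norm2_mat Binv * \<epsilon>)"
        using K\<delta> unfolding \<eta>_def[symmetric] by linarith+
    qed
  qed
qed

end
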